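(* Let $\bar x\notin\Omega$ be a point with $r:=T^F_\Omega(\bar x)<\infty$ around which the minimal time function $T^F_\Omega$ is continuous. Then $$\partial_\ge T^F_\Omega(\bar x)\subset N(\bar x;\Omega_r)\cap C^*\quad\text{and}\quad\partial^\infty_\ge T^F_\Omega(\bar x)\subset N(\bar x;\Omega_r)\cap F^*_+.$$ The first inclusion can be replaced by the equality $$\partial_\ge T^F_\Omega(\bar x)=N(\bar x;\Omega_r)\cap S^*$$ if the support function $\sigma_F$ is sequentially weak$^*$ continuous on the set $-[N(\bar x;\Omega_r)\cap C^*]$ and if $T^F_\Omega$ is locally Lipschitzian around $\bar x$. Furthermore, the representation $$N(\bar x;\Omega_r)=\bigcup_{\lambda\ge0}\lambda\,\partial_\ge T^F_\Omega(\bar x)$$ holds, with the convention $0\times\emptyset=\{0\}$, provided that $0\in\mathrm{int}\,F$.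
   Context: $X$ is an arbitrary (real) Banach space with topological dual $X^*$ and pairing $\langle\cdot,\cdot\rangle$; $\xrightarrow{w^*}$ denotes weak$^*$ convergence of sequences in $X^*$. Standing assumptions: $\Omega\subset X$ is nonempty and closed; $F\subset X$ is nonempty, closed, bounded and convex (in general it is not assumed that $0\in\mathrm{int}\,F$). The minimal time function is $T^F_\Omega(x):=\inf\{t\ge 0\mid \Omega\cap(x+tF)\ne\emptyset\}\in[0,\infty]$, with $\inf\emptyset=\infty$; for $r>0$ the enlargement of $\Omega$ is $\Omega_r:=\{x\in X\mid T^F_\Omega(x)\le r\}$. The support function of $F$ is $\sigma_F(x^* ):=\sup_{x\in F}\langle x^*,x\rangle$. Put $C^*:=\{x^*\in X^*\mid\sigma_F(-x^* )\le1\}$, $S^*:=\{x^*\in X^*\mid\sigma_F(-x^* )=1\}$, $F^*_+:=\{x^*\in X^*\mid\langle x^*,v\rangle\ge0\text{ for all }v\in F\}$. For $\varepsilon\ge0$ and $\Theta\subset X$, the set of $\varepsilon$-normals at $x\in\Theta$ is $\widehat N_\varepsilon(x;\Theta):=\{x^*\in X^*\mid \limsup_{u\to x,\,u\in\Theta}\frac{\langle x^*,u-x\rangle}{\|u-x\|}\le\varepsilon\}$, and $\widehat N_\varepsilon(x;\Theta):=\emptyset$ if $x\notin\Theta$. The basic (limiting) normal cone $N(\bar x;\Theta)$ is the set of $x^*\in X^*$ for which there are sequences $\varepsilon_k\downarrow0$, $x_k\to\bar x$, $x_k^*\xrightarrow{w^*}x^*$ with $x_k^*\in\widehat N_{\varepsilon_k}(x_k;\Theta)$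 for all $k$. For $\varphi:X\to(-\infty,\infty]$ and $x$ with $\varphi(x)<\infty$, $\widehat\partial_\varepsilon\varphi(x):=\{x^*\in X^*\mid\liminf_{u\to x}\frac{\varphi(u)-\varphi(x)-\langle x^*,u-x\rangle}{\|u-x\|}\ge-\varepsilon\}$. For $\varphi(\bar x)<\infty$: the one-sided basic subdifferential $\partial_\ge\varphi(\bar x)$ is the set of $x^*$ for which there are sequences $\varepsilon_k\downarrow0$, $x_k\to\bar x$ with $\varphi(x_k)\to\varphi(\bar x)$ and $\varphi(x_k)\ge\varphi(\bar x)$, and $x_k^*\in\widehat\partial_{\varepsilon_k}\varphi(x_k)$ with $x_k^*\xrightarrow{w^*}x^*$; the one-sided singular subdifferential $\partial^\infty_\ge\varphi(\bar x)$ is the set of $x^*$ for which there are sequences $\varepsilon_k\downarrow0$, $\lambda_k\downarrow0$ ($\lambda_k>0$), $x_k\to\bar x$ with $\varphi(x_k)\to\varphi(\bar x)$ and $\varphi(x_k)\ge\varphi(\bar x)$, and $x_k^*\in\widehat\partial_{\varepsilon_k}\varphi(x_k)$ with $\lambda_kx_k^*\xrightarrow{w^*}x^*$. A function $\psi:X^*\to(-\infty,\infty]$ is sequentially weak$^*$ continuous on $S\subset X^*$ if for every $x^*\in S$ and every sequence $x_k^*\xrightarrow{w^*}x^*$ in $X^*$ one has $\psi(x_k^* )\to\psi(x^* )$. *)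

theory Defs
  imports "HOL-Analysis.Analysis"
begin

text \<open>The dual of a real Banach space \<open>'a\<close> is the type \<open>'a \<Rightarrow>\<^sub>L real\<close>. Extended-real-valued
  functions and all limits superior and inferior are taken in \<open>ereal\<close>; in particular
  \<open>Inf {} = \<infinity>\<close> and the limit superior along the trivial filter is \<open>-\<infinity>\<close>.\<close>

text \<open>For real-valued operators, the strong operator topology (pointwise convergence) is the
  weak* topology.\<close>

definition weak_star_tendsto :: "(nat \<Rightarrow> ('a::real_normed_vector \<Rightarrow>\<^sub>L real)) \<Rightarrow> ('a \<Rightarrow>\<^sub>L real) \<Rightarrow> bool" where
  "weak_star_tendsto xs x \<longleftrightarrow> limitin strong_operator_topology xs x sequentially"

lemma weak_star_tendsto_iff:
  "weak_star_tendsto xs x \<longleftrightarrow> (\<forall>v. (\<lambda>k. blinfun_apply (xs k) v) \<longlonglongrightarrow> blinfun_apply x v)"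
proof -
  have "weak_star_tendsto xs x \<longleftrightarrow>
      limitin euclidean (\<lambda>k. blinfun_apply (xs k)) (blinfun_apply x) sequentially"
    unfolding weak_star_tendsto_def limitin_def strong_operator_topology_def
    by (auto simp: openin_pullback_topology topspace_pullback_topology)
  also have "\<dots> \<longleftrightarrow>
      (\<forall>v. (\<lambda>k. blinfun_apply (xs k) v) \<longlonglongrightarrow> blinfun_apply x v)"
    by (subst euclidean_product_topology[symmetric]) (simp add: limitin_componentwise)
  finally show ?thesis .
qed

definition seq_weak_star_continuous_on ::
    "('a::real_normed_vector \<Rightarrow>\<^sub>L real) set \<Rightarrow> (('a \<Rightarrow>\<^sub>L real) \<Rightarrow> ereal) \<Rightarrow> bool" where
  "seq_weak_star_continuous_on S \<psi> \<longleftrightarrow>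
     (\<forall>x\<in>S. \<forall>xs. weak_star_tendsto xs x \<longrightarrow> (\<lambda>k. \<psi> (xs k)) \<longlonglongrightarrow> \<psi> x)"

definition minimal_time :: "'a::real_normed_vector set \<Rightarrow> 'a set \<Rightarrow> 'a \<Rightarrow> ereal" where
  "minimal_time \<Omega> F x = Inf {ereal t | t. t \<ge> 0 \<and> \<Omega> \<inter> (\<lambda>v. x + t *\<^sub>R v) ` F \<noteq> {}}"

definition enlargement :: "'a::real_normed_vector set \<Rightarrow> 'a set \<Rightarrow> real \<Rightarrow> 'a set" where
  "enlargement \<Omega> F r = {x. minimal_time \<Omega> F x \<le> ereal r}"

definition support_fun :: "'a::real_normed_vector set \<Rightarrow> ('a \<Rightarrow>\<^sub>L real) \<Rightarrow> ereal" where
  "support_fun F xs = (SUP v\<in>F. ereal (blinfun_apply xs v))"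

definition C_star :: "'a::real_normed_vector set \<Rightarrow> ('a \<Rightarrow>\<^sub>L real) set" where
  "C_star F = {xs. support_fun F (- xs) \<le> 1}"

definition S_star :: "'a::real_normed_vector set \<Rightarrow> ('a \<Rightarrow>\<^sub>L real) set" where
  "S_star F = {xs. support_fun F (- xs) = 1}"

definition F_star_plus :: "'a::real_normed_vector set \<Rightarrow> ('a \<Rightarrow>\<^sub>L real) set" where
  "F_star_plus F = {xs. \<forall>v\<in>F. blinfun_apply xs v \<ge> 0}"

text \<open>At an isolated point of \<open>\<Theta>\<close> the filter \<open>at x within \<Theta>\<close> is trivial, and every functional is
  an \<open>\<epsilon>\<close>-normal.\<close>

definition eps_normals :: "real \<Rightarrow> 'a::real_normed_vector \<Rightarrow> 'a set \<Rightarrow> ('a \<Rightarrow>\<^sub>L real) set" where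
  "eps_normals \<epsilon> x \<Theta> =
     (if x \<in> \<Theta>
      then {xs. Limsup (at x within \<Theta>)
                  (\<lambda>u. ereal (blinfun_apply xs (u - x) / norm (u - x))) \<le> ereal \<epsilon>}
      else {})"

text \<open>Throughout, \<open>\<epsilon>\<^sub>k \<down> 0\<close> means that \<open>\<epsilon>\<^sub>k \<ge> 0\<close> tends to \<open>0\<close>, and \<open>\<lambda>\<^sub>k \<down> 0\<close> that \<open>\<lambda>\<^sub>k > 0\<close> tends
  to \<open>0\<close>. Requiring these sequences to be monotone as well gives the same sets: replace
  \<open>\<epsilon>\<^sub>k\<close> by the supremum of its tail, and pass to a subsequence for \<open>\<lambda>\<^sub>k\<close>.\<close>

definition normal_cone :: "'a::real_normed_vector \<Rightarrow> 'a set \<Rightarrow> ('a \<Rightarrow>\<^sub>L real) set" where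
  "normal_cone xbar \<Theta> =
     {xs. \<exists>(\<epsilon> :: nat \<Rightarrow> real) x xss.
        (\<forall>k. \<epsilon> k \<ge> 0) \<and> \<epsilon> \<longlonglongrightarrow> 0 \<and> x \<longlonglongrightarrow> xbar \<and> weak_star_tendsto xss xs \<and>
        (\<forall>k. xss k \<in> eps_normals (\<epsilon> k) (x k) \<Theta>)}"

definition eps_subdiff ::
    "real \<Rightarrow> ('a::real_normed_vector \<Rightarrow> ereal) \<Rightarrow> 'a \<Rightarrow> ('a \<Rightarrow>\<^sub>L real) set" where
  "eps_subdiff \<epsilon> \<phi> x =
     (if \<phi> x < \<infinity>
      then {xs. Liminf (at x)
                  (\<lambda>u. (\<phi> u - \<phi> x - ereal (blinfun_apply xs (u - x))) / ereal (norm (u - x)))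
                \<ge> ereal (- \<epsilon>)}
      else {})"

definition onesided_subdiff ::
    "('a::real_normed_vector \<Rightarrow> ereal) \<Rightarrow> 'a \<Rightarrow> ('a \<Rightarrow>\<^sub>L real) set" where
  "onesided_subdiff \<phi> xbar =
     {xs. \<phi> xbar < \<infinity> \<and> (\<exists>(\<epsilon> :: nat \<Rightarrow> real) x xss.
        (\<forall>k. \<epsilon> k \<ge> 0) \<and> \<epsilon> \<longlonglongrightarrow> 0 \<and>
        x \<longlonglongrightarrow> xbar \<and> (\<lambda>k. \<phi> (x k)) \<longlonglongrightarrow> \<phi> xbar \<and> (\<forall>k. \<phi> (x k) \<ge> \<phi> xbar) \<and>
        (\<forall>k. xss k \<in> eps_subdiff (\<epsilon> k) \<phi> (x k)) \<and> weak_star_tendsto xss xs)}"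

definition onesided_singular_subdiff ::
    "('a::real_normed_vector \<Rightarrow> ereal) \<Rightarrow> 'a \<Rightarrow> ('a \<Rightarrow>\<^sub>L real) set" where
  "onesided_singular_subdiff \<phi> xbar =
     {xs. \<phi> xbar < \<infinity> \<and> (\<exists>(\<epsilon> :: nat \<Rightarrow> real) (lam :: nat \<Rightarrow> real) x xss.
        (\<forall>k. \<epsilon> k \<ge> 0) \<and> \<epsilon> \<longlonglongrightarrow> 0 \<and> (\<forall>k. lam k > 0) \<and> lam \<longlonglongrightarrow> 0 \<and>
        x \<longlonglongrightarrow> xbar \<and> (\<lambda>k. \<phi> (x k)) \<longlonglongrightarrow> \<phi> xbar \<and> (\<forall>k. \<phi> (x k) \<ge> \<phi> xbar) \<and>
        (\<forall>k. xss k \<in> eps_subdiff (\<epsilon> k) \<phi> (x k)) \<and>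
        weak_star_tendsto (\<lambda>k. lam k *\<^sub>R xss k) xs)}"

definition continuous_around :: "('a::real_normed_vector \<Rightarrow> ereal) \<Rightarrow> 'a \<Rightarrow> bool" where
  "continuous_around \<phi> x \<longleftrightarrow> (\<exists>U. open U \<and> x \<in> U \<and> continuous_on U \<phi>)"

definition locally_lipschitz_around :: "('a::real_normed_vector \<Rightarrow> ereal) \<Rightarrow> 'a \<Rightarrow> bool" where
  "locally_lipschitz_around \<phi> x \<longleftrightarrow>
     (\<exists>U L. open U \<and> x \<in> U \<and> (\<forall>u\<in>U. \<bar>\<phi> u\<bar> \<noteq> \<infinity>) \<and>
        L-lipschitz_on U (\<lambda>u. real_of_ereal (\<phi> u)))"

text \<open>Dilation of a set with the convention \<open>0 \<times> {} = {0}\<close>.\<close>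

definition dilate :: "real \<Rightarrow> 'b::real_vector set \<Rightarrow> 'b set" where
  "dilate c A = (if c = 0 \<and> A = {} then {0} else (\<lambda>x. c *\<^sub>R x) ` A)"

end

theory Submission
  imports Defs
begin

text \<open>Write \<open>T\<close> for the minimal time function and \<open>E\<close> for the enlargement of level \<open>r\<close>. Two facts link
  \<open>T\<close> to its sublevel set \<open>E\<close>. A trajectory that reaches the target from a point of time \<open>s \<ge> r\<close> passes
  through \<open>E\<close> with time \<open>r\<close> left, and by convexity of \<open>F\<close> moving backwards along a direction in
  \<open>F\<close> raises \<open>T\<close> at rate at most \<open>1\<close>.

  The second fact bounds \<open>\<epsilon>\<close>-subgradients and gives \<open>C_star\<close> and \<open>F_star_plus\<close> in the limit. For normality,
  an \<open>\<epsilon>\<close>-subgradient at \<open>x\<close> with \<open>T x \<ge> r\<close> is transported along an almost optimal trajectory to the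
  point where the trajectory enters \<open>E\<close>. There it is an \<open>\<epsilon>\<close>-normal up to an additive error, since optimal
  trajectories need not exist, and Ekeland's variational principle removes the error at the cost of a
  small displacement (\<open>eps_normals_near_of_eps_subdiff_minimal_time\<close>). Points \<open>x\<close> tending to
  \<open>xbar\<close> with \<open>T x\<close> tending to \<open>r\<close> are displaced by amounts tending to \<open>0\<close>, so that limits of subgradients
  are limits of normals. This is where the one-sided approach \<open>T x \<ge> r\<close> matters.

  Conversely, an \<open>\<epsilon>\<close>-normal to \<open>E\<close> at a point of time exactly \<open>r\<close>, normalised so that the support function
  of \<open>F\<close> at its negative is \<open>1\<close>, is an \<open>\<epsilon>'\<close>-subgradient of \<open>T\<close> if \<open>T\<close> is Lipschitzian nearby
  (\<open>eps_subdiff_minimal_time_of_eps_normals\<close>). A weak* limit of normals is therefore a one-sided subgradient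
  once it is divided by a positive limit of the normalising factors. Weak* continuity of the support
  function makes that limit \<open>1\<close> on \<open>S_star\<close>, which gives the equality. If \<open>0\<close> is interior to \<open>F\<close>,
  boundedness of weak* convergent sequences yields a convergent subsequence of the factors, and its limit
  is positive, which gives the representation of the whole normal cone.\<close>

section \<open>Epsilon-normals, epsilon-subgradients and their limits\<close>

text \<open>The slack \<open>\<gamma>\<close> absorbs the limit superior, and multiplying by \<open>norm (u - x)\<close> removes the
  quotient. The form with \<open>u = x\<close> allowed also covers isolated points of \<open>\<Theta>\<close>.\<close>

lemma eps_normals_iff:
  "xs \<in> eps_normals \<epsilon> x \<Theta> \<longleftrightarrow> x \<in> \<Theta> \<and>
     (\<forall>\<gamma>>0. \<exists>\<delta>>0. \<forall>u\<in>\<Theta>. norm (u - x) < \<delta> \<longrightarrow> blinfun_apply xs (u - x) \<le> (\<epsilon> + \<gamma>) * norm (u - x))"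
proof (cases "x \<in> \<Theta>")
  case True
  let ?q = "\<lambda>u. blinfun_apply xs (u - x) / norm (u - x)"
  have "xs \<in> eps_normals \<epsilon> x \<Theta> \<longleftrightarrow>
      (\<forall>y>ereal \<epsilon>. eventually (\<lambda>u. ereal (?q u) < y) (at x within \<Theta>))"
    using True by (simp add: eps_normals_def Limsup_le_iff)
  also have "\<dots> \<longleftrightarrow> (\<forall>\<gamma>>0. eventually (\<lambda>u. ?q u \<le> \<epsilon> + \<gamma>) (at x within \<Theta>))"
  proof (intro iffI allI impI)
    fix \<gamma> :: real
    assume *: "\<forall>y>ereal \<epsilon>. eventually (\<lambda>u. ereal (?q u) < y) (at x within \<Theta>)" and "0 < \<gamma>"
    have "eventually (\<lambda>u. ereal (?q u) < ereal (\<epsilon> + \<gamma>)) (at x within \<Theta>)"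
      by (rule *[rule_format]) (use \<open>0 < \<gamma>\<close> in simp)
    then show "eventually (\<lambda>u. ?q u \<le> \<epsilon> + \<gamma>) (at x within \<Theta>)"
      by (rule eventually_mono) simp
  next
    fix y
    assume *: "\<forall>\<gamma>>0. eventually (\<lambda>u. ?q u \<le> \<epsilon> + \<gamma>) (at x within \<Theta>)" and y: "ereal \<epsilon> < y"
    then obtain z where z: "ereal \<epsilon> < ereal z" "ereal z < y"
      by (metis ereal_dense2)
    with *[rule_format, of "z - \<epsilon>"]
    have "eventually (\<lambda>u. ?q u \<le> z) (at x within \<Theta>)"
      by simp
    then show "eventually (\<lambda>u. ereal (?q u) < y) (at x within \<Theta>)"
      by (rule eventually_mono) (meson z(2) ereal_less_eq(3) le_less_trans)
  qed
  also have "\<dots> \<longleftrightarrow> (\<forall>\<gamma>>0. \<exists>\<delta>>0. \<forall>u\<in>\<Theta>. norm (u - x) < \<delta> \<longrightarrow>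
      blinfun_apply xs (u - x) \<le> (\<epsilon> + \<gamma>) * norm (u - x))"
  proof -
    have "(u \<noteq> x \<and> dist u x < d \<longrightarrow> ?q u \<le> c) \<longleftrightarrow>
        (norm (u - x) < d \<longrightarrow> blinfun_apply xs (u - x) \<le> c * norm (u - x))" for u d c
      by (cases "u = x") (auto simp: dist_norm divide_simps)
    then show ?thesis
      by (simp add: eventually_at)
  qed
  finally show ?thesis
    using True by simp
qed (simp add: eps_normals_def)

lemma eps_normals_scaleR:
  assumes "xs \<in> eps_normals \<epsilon> x \<Theta>" and "0 \<le> c"
  shows "c *\<^sub>R xs \<in> eps_normals (c * \<epsilon>) x \<Theta>"
proof (cases "c = 0")
  case True
  with assms show ?thesis
    by (auto simp: eps_normals_iff zero_less_one intro!: exI[of _ 1])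
next
  case False
  with assms(2) have c: "0 < c" by simp
  show ?thesis
    unfolding eps_normals_iff
  proof (intro conjI allI impI)
    show "x \<in> \<Theta>" using assms(1) by (simp add: eps_normals_iff)
    fix \<gamma> :: real assume "0 < \<gamma>"
    with c have "0 < \<gamma> / c" by simp
    with assms(1) obtain \<delta> where "0 < \<delta>"
      and d: "\<And>u. u \<in> \<Theta> \<Longrightarrow> norm (u - x) < \<delta> \<Longrightarrow>
        blinfun_apply xs (u - x) \<le> (\<epsilon> + \<gamma> / c) * norm (u - x)"
      by (auto simp: eps_normals_iff)
    have "c * blinfun_apply xs (u - x) \<le> (c * \<epsilon> + \<gamma>) * norm (u - x)"
      if "u \<in> \<Theta>" "norm (u - x) < \<delta>" for u
    proof -
      have "c * ((\<epsilon> + \<gamma> / c) * norm (u - x)) = (c * \<epsilon> + \<gamma>) * norm (u - x)"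
        using c by (simp add: field_simps)
      with mult_left_mono[OF d[OF that] assms(2)] show ?thesis by simp
    qed
    with \<open>0 < \<delta>\<close> show "\<exists>\<delta>>0. \<forall>u\<in>\<Theta>. norm (u - x) < \<delta> \<longrightarrow>
        blinfun_apply (c *\<^sub>R xs) (u - x) \<le> (c * \<epsilon> + \<gamma>) * norm (u - x)"
      by (auto simp: scaleR_blinfun.rep_eq)
  qed
qed

text \<open>At an interior point all directions \<open>v\<close> and \<open>- v\<close> are admissible, so that the \<open>\<epsilon>\<close>-normal inequality
  becomes two-sided. Where the minimal time function is Lipschitzian, this rules out points
  of time less than \<open>r\<close> as base points of large \<open>\<epsilon>\<close>-normals to \<open>enlargement \<Omega> F r\<close>.\<close>

lemma norm_le_of_eps_normals_interior:
  assumes "xs \<in> eps_normals \<epsilon> x \<Theta>" and "x \<in> interior \<Theta>" and "0 \<le> \<epsilon>"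
  shows "norm xs \<le> \<epsilon>"
proof (rule norm_blinfun_bound[OF assms(3)])
  fix v
  show "norm (blinfun_apply xs v) \<le> \<epsilon> * norm v"
  proof (rule field_le_epsilon)
    fix e :: real assume "0 < e"
    obtain \<rho> where \<rho>: "0 < \<rho>" "ball x \<rho> \<subseteq> \<Theta>"
      using assms(2) by (auto simp: mem_interior)
    define \<gamma> where "\<gamma> = e / (norm v + 1)"
    have g: "0 < \<gamma>" "\<gamma> * norm v \<le> e"
      using \<open>0 < e\<close> by (auto simp: \<gamma>_def field_simps add_pos_nonneg)
    obtain \<delta> where "0 < \<delta>"
      and d: "\<And>u. u \<in> \<Theta> \<Longrightarrow> norm (u - x) < \<delta> \<Longrightarrow>
        blinfun_apply xs (u - x) \<le> (\<epsilon> + \<gamma>) * norm (u - x)"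
      using assms(1) g(1) by (auto simp: eps_normals_iff)
    define t where "t = min \<rho> \<delta> / (2 * (norm v + 1))"
    have "norm v / (2 * (norm v + 1)) < 1"
      by (smt (verit) divide_less_eq_1_pos norm_ge_zero)
    moreover have "0 < min \<rho> \<delta>" using \<rho> \<open>0 < \<delta>\<close> by simp
    ultimately have "min \<rho> \<delta> * (norm v / (2 * (norm v + 1))) < min \<rho> \<delta> * 1"
      by (intro mult_strict_left_mono)
    then have t: "t * norm v < min \<rho> \<delta>"
      by (simp add: t_def)
    have "0 < t"
      unfolding t_def using \<open>0 < min \<rho> \<delta>\<close> by (intro divide_pos_pos) (simp_all add: add_nonneg_pos)
    have "blinfun_apply xs w \<le> (\<epsilon> + \<gamma>) * norm v" if "norm w = norm v" for w
    proof -
      have "norm (t *\<^sub>R w) < min \<rho> \<delta>"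
        using t \<open>0 < t\<close> that by simp
      then have "x + t *\<^sub>R w \<in> \<Theta>" "norm ((x + t *\<^sub>R w) - x) < \<delta>"
        using \<rho>(2) by (auto simp: subset_iff dist_norm)
      from d[OF this] have "t * blinfun_apply xs w \<le> t * ((\<epsilon> + \<gamma>) * norm v)"
        using \<open>0 < t\<close> that by (simp add: blinfun.scaleR_right ac_simps)
      then show ?thesis using \<open>0 < t\<close> by (rule mult_left_le_imp_le)
    qed
    from this[of v] this[of "- v"]
    have "blinfun_apply xs v \<le> (\<epsilon> + \<gamma>) * norm v" "- blinfun_apply xs v \<le> (\<epsilon> + \<gamma>) * norm v"
      by (simp_all add: blinfun.minus_right)
    with g(2) show "norm (blinfun_apply xs v) \<le> \<epsilon> * norm v + e"
      by (simp add: algebra_simps abs_le_iff)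
  qed
qed

lemma eps_subdiff_iff:
  assumes "\<bar>\<phi> x\<bar> \<noteq> \<infinity>"
  shows "xs \<in> eps_subdiff \<epsilon> \<phi> x \<longleftrightarrow>
     (\<forall>\<gamma>>0. \<exists>\<delta>>0. \<forall>u. norm (u - x) < \<delta> \<longrightarrow>
        \<phi> x + ereal (blinfun_apply xs (u - x) - (\<epsilon> + \<gamma>) * norm (u - x)) \<le> \<phi> u)"
proof -
  from assms obtain a where a: "\<phi> x = ereal a" by auto
  let ?q = "\<lambda>u. (\<phi> u - \<phi> x - ereal (blinfun_apply xs (u - x))) / ereal (norm (u - x))"
  have "xs \<in> eps_subdiff \<epsilon> \<phi> x \<longleftrightarrow> (\<forall>y<ereal (- \<epsilon>). eventually (\<lambda>u. y < ?q u) (at x))"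
    using a by (simp add: eps_subdiff_def le_Liminf_iff)
  also have "\<dots> \<longleftrightarrow> (\<forall>\<gamma>>0. eventually (\<lambda>u. ereal (- (\<epsilon> + \<gamma>)) \<le> ?q u) (at x))"
  proof (intro iffI allI impI)
    fix \<gamma> :: real
    assume *: "\<forall>y<ereal (- \<epsilon>). eventually (\<lambda>u. y < ?q u) (at x)" and "0 < \<gamma>"
    have "eventually (\<lambda>u. ereal (- (\<epsilon> + \<gamma>)) < ?q u) (at x)"
      by (rule *[rule_format]) (use \<open>0 < \<gamma>\<close> in simp)
    then show "eventually (\<lambda>u. ereal (- (\<epsilon> + \<gamma>)) \<le> ?q u) (at x)"
      by (rule eventually_mono) (rule less_imp_le)
  next
    fix y
    assume *: "\<forall>\<gamma>>0. eventually (\<lambda>u. ereal (- (\<epsilon> + \<gamma>)) \<le> ?q u) (at x)" and y: "y < ereal (- \<epsilon>)"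
    then obtain z where z: "y < ereal z" "ereal z < ereal (- \<epsilon>)"
      by (metis ereal_dense2)
    with *[rule_format, of "- \<epsilon> - z"]
    have "eventually (\<lambda>u. ereal z \<le> ?q u) (at x)"
      by simp
    then show "eventually (\<lambda>u. y < ?q u) (at x)"
      by (rule eventually_mono) (rule less_le_trans[OF z(1)])
  qed
  also have "\<dots> \<longleftrightarrow> (\<forall>\<gamma>>0. \<exists>\<delta>>0. \<forall>u. norm (u - x) < \<delta> \<longrightarrow>
        \<phi> x + ereal (blinfun_apply xs (u - x) - (\<epsilon> + \<gamma>) * norm (u - x)) \<le> \<phi> u)"
  proof -
    have "(u \<noteq> x \<and> dist u x < d \<longrightarrow> ereal (- c) \<le> ?q u) \<longleftrightarrow>
        (norm (u - x) < d \<longrightarrow>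
           \<phi> x + ereal (blinfun_apply xs (u - x) - c * norm (u - x)) \<le> \<phi> u)" for u d c
    proof (cases "u = x")
      case False
      then have n: "0 < norm (u - x)" by simp
      then have "ereal (- c) \<le> ?q u \<longleftrightarrow>
          \<phi> x + ereal (blinfun_apply xs (u - x) - c * norm (u - x)) \<le> \<phi> u"
        using a by (cases "\<phi> u") (auto simp: field_simps)
      with False show ?thesis by (simp add: dist_norm)
    qed (simp add: a)
    then show ?thesis
      unfolding eventually_at by (simp only: ball_UNIV)
  qed
  finally show ?thesis .
qed

lemma normal_coneI:
  assumes "\<And>k. 0 \<le> \<epsilon> k" and "\<epsilon> \<longlonglongrightarrow> 0" and "x \<longlonglongrightarrow> xbar" and "weak_star_tendsto xss xs"
    and "\<And>k. xss k \<in> eps_normals (\<epsilon> k) (x k) \<Theta>"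
  shows "xs \<in> normal_cone xbar \<Theta>"
  unfolding normal_cone_def mem_Collect_eq using assms by (intro exI[of _ \<epsilon>] exI[of _ x] exI[of _ xss]) simp

lemma normal_cone_scaleR:
  assumes "xs \<in> normal_cone xbar \<Theta>" and "0 \<le> c"
  shows "c *\<^sub>R xs \<in> normal_cone xbar \<Theta>"
proof -
  obtain \<epsilon> x xss where *: "\<And>k. 0 \<le> \<epsilon> k" "\<epsilon> \<longlonglongrightarrow> 0" "x \<longlonglongrightarrow> xbar" "weak_star_tendsto xss xs"
      "\<And>k. xss k \<in> eps_normals (\<epsilon> k) (x k) \<Theta>"
    using assms(1) by (auto simp: normal_cone_def)
  show ?thesis
  proof (rule normal_coneI[OF _ _ *(3)])
    show "0 \<le> c * \<epsilon> k" for k using *(1) assms(2) by simp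
    show "(\<lambda>k. c * \<epsilon> k) \<longlonglongrightarrow> 0"
      using tendsto_mult_left[OF *(2), of c] by simp
    show "weak_star_tendsto (\<lambda>k. c *\<^sub>R xss k) (c *\<^sub>R xs)"
      using *(4) by (auto simp: weak_star_tendsto_iff scaleR_blinfun.rep_eq intro: tendsto_mult_left)
    show "c *\<^sub>R xss k \<in> eps_normals (c * \<epsilon> k) (x k) \<Theta>" for k
      by (rule eps_normals_scaleR[OF *(5) assms(2)])
  qed
qed

lemma zero_in_normal_cone:
  fixes x :: "'a::real_normed_vector"
  assumes "x \<in> \<Theta>"
  shows "0 \<in> normal_cone x \<Theta>"
proof (rule normal_coneI)
  show "(0 :: 'a \<Rightarrow>\<^sub>L real) \<in> eps_normals 0 x \<Theta>" for k :: nat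
    using assms zero_less_one by (auto simp: eps_normals_iff)
qed (simp_all add: weak_star_tendsto_iff)

lemma onesided_subdiffI:
  assumes "\<phi> xbar < \<infinity>" and "\<And>k. 0 \<le> \<epsilon> k" and "\<epsilon> \<longlonglongrightarrow> 0" and "x \<longlonglongrightarrow> xbar"
    and "\<And>k. \<phi> (x k) = \<phi> xbar" and "\<And>k. xss k \<in> eps_subdiff (\<epsilon> k) \<phi> (x k)"
    and "weak_star_tendsto xss xs"
  shows "xs \<in> onesided_subdiff \<phi> xbar"
  unfolding onesided_subdiff_def mem_Collect_eq
  using assms by (intro conjI exI[of _ \<epsilon>] exI[of _ x] exI[of _ xss]) simp_all

section \<open>The minimal time function\<close>

lemma minimal_time_nonneg: "0 \<le> minimal_time \<Omega> F x"
  unfolding minimal_time_def by (rule Inf_greatest) auto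

lemma minimal_time_le:
  assumes "0 \<le> t" and "f \<in> F" and "x + t *\<^sub>R f \<in> \<Omega>"
  shows "minimal_time \<Omega> F x \<le> ereal t"
  unfolding minimal_time_def using assms by (intro Inf_lower) auto

lemma minimal_time_lessE:
  assumes "minimal_time \<Omega> F x < s"
  obtains t f where "0 \<le> t" and "ereal t < s" and "f \<in> F" and "x + t *\<^sub>R f \<in> \<Omega>"
    and "minimal_time \<Omega> F x \<le> ereal t"
proof -
  from assms obtain t f where "0 \<le> t" "ereal t < s" "f \<in> F" "x + t *\<^sub>R f \<in> \<Omega>"
    unfolding minimal_time_def Inf_less_iff by blast
  with that minimal_time_le show thesis by blast
qed

text \<open>Moving backwards along \<open>v\<close> for time \<open>t\<close> costs at most \<open>t\<close>: go forward along \<open>v\<close> and then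
  along an almost optimal direction \<open>f\<close>. By convexity of \<open>F\<close> the two legs, of durations \<open>t\<close> and \<open>s\<close>,
  are one trip of duration \<open>s + t\<close> along a convex combination of \<open>f\<close> and \<open>v\<close>.\<close>

lemma minimal_time_diff_le:
  assumes "convex F" and "v \<in> F" and "0 \<le> t"
  shows "minimal_time \<Omega> F (x - t *\<^sub>R v) \<le> minimal_time \<Omega> F x + ereal t"
proof (rule ereal_le_epsilon2)
  fix e :: real assume "0 < e"
  show "minimal_time \<Omega> F (x - t *\<^sub>R v) \<le> minimal_time \<Omega> F x + ereal t + ereal e"
  proof (cases "minimal_time \<Omega> F x = \<infinity>")
    case False
    with minimal_time_nonneg[of \<Omega> F x] obtain a where a: "minimal_time \<Omega> F x = ereal a" "0 \<le> a"
      by (cases "minimal_time \<Omega> F x") auto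
    from \<open>0 < e\<close> a(1) have "minimal_time \<Omega> F x < ereal (a + e)" by simp
    then obtain s f where s: "0 \<le> s" "ereal s < ereal (a + e)" "f \<in> F" "x + s *\<^sub>R f \<in> \<Omega>"
      by (rule minimal_time_lessE)
    \<comment> \<open>If \<open>s + t = 0\<close>, nothing moves and the convex weights would be undefined.\<close>
    show ?thesis
    proof (cases "s + t = 0")
      case True
      with s(1) assms(3) have "s = 0" "t = 0" by auto
      with \<open>0 < e\<close> a show ?thesis by simp
    next
      case False
      with s(1) assms(3) have p: "0 < s + t" by simp
      define g where "g = (s / (s + t)) *\<^sub>R f + (t / (s + t)) *\<^sub>R v"
      have "g \<in> F"
        unfolding g_def using p s assms
        by (intro convexD[OF assms(1)]) (auto simp: add_divide_distrib[symmetric])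
      moreover have "(x - t *\<^sub>R v) + (s + t) *\<^sub>R g = x + s *\<^sub>R f"
        using p by (simp add: g_def scaleR_add_right)
      ultimately have "minimal_time \<Omega> F (x - t *\<^sub>R v) \<le> ereal (s + t)"
        using p s(4) by (intro minimal_time_le[where f=g]) (simp_all only: less_imp_le)
      also have "\<dots> \<le> minimal_time \<Omega> F x + ereal t + ereal e"
        using s(2) a by simp
      finally show ?thesis .
    qed
  qed simp
qed

lemma minimal_time_pos:
  assumes "closed \<Omega>" and "bounded F" and "x \<notin> \<Omega>"
  shows "0 < minimal_time \<Omega> F x"
proof -
  obtain M where M: "0 < M" "\<And>f. f \<in> F \<Longrightarrow> norm f \<le> M"
    using assms(2) by (auto simp: bounded_pos)
  obtain \<rho> where \<rho>: "0 < \<rho>" "ball x \<rho> \<inter> \<Omega> = {}"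
    using assms(1,3) by (metis Compl_iff disjoint_eq_subset_Compl open_Compl open_contains_ball)
  have "ereal (\<rho> / M) \<le> minimal_time \<Omega> F x"
  proof (rule ccontr)
    assume "\<not> ?thesis"
    then have "minimal_time \<Omega> F x < ereal (\<rho> / M)" by simp
    then obtain t f where t: "0 \<le> t" "ereal t < ereal (\<rho> / M)" "f \<in> F" "x + t *\<^sub>R f \<in> \<Omega>"
      by (rule minimal_time_lessE)
    have "norm (t *\<^sub>R f) \<le> t * M"
      using t(1) M(2)[OF t(3)] by (simp add: mult_left_mono)
    also have "\<dots> < \<rho>"
      using t(2) M(1) by (simp add: field_simps)
    finally have "x + t *\<^sub>R f \<in> ball x \<rho>"
      by (simp add: dist_norm)
    with \<rho>(2) t(4) show False by blast
  qed
  moreover have "0 < ereal (\<rho> / M)" using \<rho> M by simp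
  ultimately show ?thesis by (rule less_le_trans[rotated])
qed

lemma minimal_time_real_of_eps_subdiff:
  assumes "xs \<in> eps_subdiff \<epsilon> (minimal_time \<Omega> F) x"
  obtains a where "minimal_time \<Omega> F x = ereal a"
  using assms minimal_time_nonneg[of \<Omega> F x]
  by (cases "minimal_time \<Omega> F x") (auto simp: eps_subdiff_def)

text \<open>If \<open>F\<close> contains a ball of radius \<open>d\<close> around \<open>0\<close>, one can travel from \<open>u\<close> to \<open>x\<close> in time
  \<open>norm (u - x) / d\<close>.\<close>

lemma locally_lipschitz_minimal_time:
  assumes "convex F" and "0 \<in> interior F" and "minimal_time \<Omega> F xbar < \<infinity>"
  shows "locally_lipschitz_around (minimal_time \<Omega> F) xbar"
proof -
  obtain d where d: "0 < d" "cball 0 d \<subseteq> F"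
    using assms(2) by (metis mem_interior_cball)
  have le: "minimal_time \<Omega> F u \<le> minimal_time \<Omega> F x + ereal (norm (u - x) / d)" for u x
  proof (cases "u = x")
    case False
    define t where "t = norm (u - x) / d"
    have "0 < t" using False d by (simp add: t_def)
    have "(- 1 / t) *\<^sub>R (u - x) \<in> F"
      using d False by (intro subsetD[OF d(2)]) (simp add: t_def)
    moreover have "x - t *\<^sub>R ((- 1 / t) *\<^sub>R (u - x)) = u" using \<open>0 < t\<close> by simp
    ultimately show ?thesis
      using minimal_time_diff_le[OF assms(1), of _ t \<Omega> x] \<open>0 < t\<close> unfolding t_def[symmetric]
      by (metis less_imp_le)
  qed simp
  have fin: "\<bar>minimal_time \<Omega> F u\<bar> \<noteq> \<infinity>" for u
    using le[of u xbar] assms(3) minimal_time_nonneg[of \<Omega> F u] by auto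
  have "(1/d)-lipschitz_on UNIV (\<lambda>u. real_of_ereal (minimal_time \<Omega> F u))"
  proof (rule lipschitz_onI)
    fix u x
    obtain a b where ab: "minimal_time \<Omega> F u = ereal a" "minimal_time \<Omega> F x = ereal b"
      using fin[of u] fin[of x] by auto
    with le[of u x] le[of x u]
    show "dist (real_of_ereal (minimal_time \<Omega> F u)) (real_of_ereal (minimal_time \<Omega> F x)) \<le> 1/d * dist u x"
      by (simp add: dist_norm norm_minus_commute abs_le_iff)
  qed (use d in simp)
  with fin show ?thesis
    unfolding locally_lipschitz_around_def by (intro exI[of _ UNIV] exI[of _ "1/d"]) auto
qed

section \<open>Two principles for complete spaces\<close>

text \<open>The usual proof: \<open>G u\<close> is the set of points that improve on \<open>u\<close> by at least \<open>c\<close> times their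
  distance from it. Membership in \<open>G\<close> is transitive, and moving each time to an almost minimal value of
  \<open>f\<close> on the current set makes the diameters shrink to \<open>0\<close>. The limit can no longer be improved. The
  principle replaces nearest points, which need not exist in a Banach space.\<close>

theorem Ekeland_variational_principle:
  fixes f :: "'a::metric_space \<Rightarrow> real"
  assumes "complete S" and "continuous_on S f" and "w \<in> S" and "0 < c"
    and low: "\<And>u. u \<in> S \<Longrightarrow> f w \<le> f u + \<eta>"
  obtains y where "y \<in> S" and "c * dist w y \<le> \<eta>" and "\<And>u. u \<in> S \<Longrightarrow> f y \<le> f u + c * dist y u"
proof -
  define G where "G = (\<lambda>u. {v \<in> S. f v + c * dist u v \<le> f u})"
  have G_self: "u \<in> G u" if "u \<in> S" for u
    using that by (simp add: G_def)
  have G_trans: "v' \<in> G u" if "v \<in> G u" "v' \<in> G v" for u v v'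
  proof -
    have "c * dist u v' \<le> c * dist u v + c * dist v v'"
      using \<open>0 < c\<close> dist_triangle[of u v' v] by (simp add: distrib_left[symmetric])
    with that show ?thesis by (auto simp: G_def)
  qed
  have bdd: "bdd_below (f ` A)" if "A \<subseteq> S" for A
    using that low by (intro bdd_belowI2[of _ "f w - \<eta>"]) (auto simp: algebra_simps)
  have step: "\<exists>v. v \<in> G u \<and> (\<forall>z\<in>G u. f v \<le> f z + (1/2)^n)" if uS: "u \<in> S" for u and n :: nat
  proof -
    have "Inf (f ` G u) < Inf (f ` G u) + (1/2)^n" by simp
    then obtain v where "v \<in> G u" "f v < Inf (f ` G u) + (1/2)^n"
      using G_self[OF uS] cInf_lessD[of "f ` G u"] by blast
    moreover have "Inf (f ` G u) \<le> f z" if "z \<in> G u" for z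
      using that bdd[of "G u"] by (intro cInf_lower) (auto simp: G_def)
    ultimately show ?thesis by force
  qed
  define nxt where "nxt = (\<lambda>n u. SOME v. v \<in> G u \<and> (\<forall>z\<in>G u. f v \<le> f z + (1/2)^n))"
  have nxt: "\<And>u n. u \<in> S \<Longrightarrow> nxt n u \<in> G u"
    "\<And>u n z. u \<in> S \<Longrightarrow> z \<in> G u \<Longrightarrow> f (nxt n u) \<le> f z + (1/2)^n"
    using someI_ex[OF step] unfolding nxt_def by blast+
  define x where "x = rec_nat w nxt"
  have x0: "x 0 = w" and xS: "x (Suc n) = nxt n (x n)" for n
    by (simp_all add: x_def)
  have xin: "x n \<in> S" for n
    by (induction n) (use \<open>w \<in> S\<close> nxt(1) in \<open>auto simp: x0 xS G_def\<close>)
  have chain: "x m \<in> G (x n)" if "n \<le> m" for n m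
    using that
    by (induction m rule: dec_induct) (use xin nxt(1) G_trans G_self in \<open>auto simp: xS\<close>)
  have small: "c * dist (x (Suc n)) z \<le> (1/2)^n" if "z \<in> G (x (Suc n))" for n z
  proof -
    have "z \<in> G (x n)" using that chain[of n "Suc n"] G_trans by auto
    then have "f (x (Suc n)) \<le> f z + (1/2)^n" using nxt(2) xin xS by simp
    with that show ?thesis by (simp add: G_def)
  qed
  have pow0: "(\<lambda>n. (1/2)^n / c) \<longlonglongrightarrow> (0::real)"
    using tendsto_divide[OF LIMSEQ_power_zero[of "1/2::real"] tendsto_const[of c]] \<open>0 < c\<close> by simp
  have "Cauchy x"
  proof (rule metric_CauchyI)
    fix e :: real assume "0 < e"
    then have "\<forall>\<^sub>F n in sequentially. (1/2)^n / c < e / 2"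
      by (intro order_tendstoD(2)[OF pow0]) simp
    then obtain N where N: "(1/2)^N / c < e / 2"
      by (auto simp: eventually_sequentially)
    have near: "dist (x (Suc N)) (x m) < e / 2" if "Suc N \<le> m" for m
    proof -
      have "dist (x (Suc N)) (x m) \<le> (1/2)^N / c"
        using small[OF chain[OF that]] \<open>0 < c\<close> by (simp add: pos_le_divide_eq mult.commute)
      with N show ?thesis by linarith
    qed
    show "\<exists>M. \<forall>m\<ge>M. \<forall>n\<ge>M. dist (x m) (x n) < e"
      using near dist_triangle_half_r by blast
  qed
  with \<open>complete S\<close> xin obtain y where y: "y \<in> S" "x \<longlonglongrightarrow> y"
    by (auto simp: complete_def)
  have fx: "(\<lambda>n. f (x n)) \<longlonglongrightarrow> f y"
    using continuous_on_tendsto_compose[OF assms(2) y(2) y(1)] xin by simp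
  have yG: "y \<in> G (x n)" for n
  proof -
    have "(\<lambda>m. f (x m) + c * dist (x n) (x m)) \<longlonglongrightarrow> f y + c * dist (x n) y"
      by (intro tendsto_intros fx y(2))
    then have "f y + c * dist (x n) y \<le> f (x n)"
      by (rule tendsto_upperbound)
        (use chain in \<open>auto simp: G_def eventually_sequentially intro!: exI[of _ n]\<close>)
    with y(1) show ?thesis by (simp add: G_def)
  qed
  show thesis
  proof (rule that[OF y(1)])
    show "c * dist w y \<le> \<eta>"
      using yG[of 0] low[OF y(1)] by (simp add: G_def x0)
    fix u assume "u \<in> S"
    show "f y \<le> f u + c * dist y u"
    proof (rule ccontr)
      assume neg: "\<not> ?thesis"
      with \<open>u \<in> S\<close> have "u \<in> G y" by (simp add: G_def)
      then have ux: "u \<in> G (x n)" for n using yG G_trans by blast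
      have "(\<lambda>n. x (Suc n)) \<longlonglongrightarrow> u"
      proof (rule metric_tendsto_imp_tendsto[OF pow0])
        show "\<forall>\<^sub>F n in sequentially. dist (x (Suc n)) u \<le> dist ((1/2)^n / c) 0"
          using small[OF ux] \<open>0 < c\<close> by (simp add: field_simps)
      qed
      moreover have "(\<lambda>n. x (Suc n)) \<longlonglongrightarrow> y"
        using y(2) by (rule LIMSEQ_Suc)
      ultimately have "u = y" by (rule LIMSEQ_unique)
      with neg show False by simp
    qed
  qed
qed

text \<open>The Banach--Steinhaus theorem. By Baire's theorem one of the closed sets \<open>C n\<close>, on which all
  members of the family are bounded by \<open>n\<close>, contains a ball; differences of points of that ball
  give a uniform bound near \<open>0\<close>.\<close>

lemma bounded_family_of_pointwise_bounded:
  fixes A :: "('a::banach \<Rightarrow>\<^sub>L 'b::real_normed_vector) set"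
  assumes "\<And>v. bounded ((\<lambda>T. blinfun_apply T v) ` A)"
  shows "bounded A"
proof -
  define C where "C = (\<lambda>n::nat. {v. \<forall>T\<in>A. norm (blinfun_apply T v) \<le> real n})"
  have closed_C: "closed (C n)" for n
  proof -
    have "C n = (\<Inter>T\<in>A. {v. norm (blinfun_apply T v) \<le> real n})" by (auto simp: C_def)
    moreover have "closed {v. norm (blinfun_apply T v) \<le> real n}" for T :: "'a \<Rightarrow>\<^sub>L 'b"
      by (intro closed_Collect_le continuous_intros)
    ultimately show ?thesis by auto
  qed
  have "(\<Union>n. C n) = UNIV"
  proof (intro set_eqI iffI UNIV_I)
    fix v
    obtain b where "\<And>T. T \<in> A \<Longrightarrow> norm (blinfun_apply T v) \<le> b"
      using assms[of v] by (auto simp: bounded_iff)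
    moreover obtain n :: nat where "b \<le> real n" using real_arch_simple by blast
    ultimately have "v \<in> C n" by (force simp: C_def)
    then show "v \<in> (\<Union>n. C n)" by blast
  qed
  moreover have "interior (\<Union>n. C n) = {}" if "\<And>n. interior (C n) = {}"
    using Baire_category_alt[of "euclidean :: 'a topology" "range C"] closed_C that
    by (auto simp: completely_metrizable_space_euclidean)
  ultimately have "\<exists>n. interior (C n) \<noteq> {}"
    by (metis interior_UNIV UNIV_not_empty)
  then obtain n x e where e: "0 < e" "ball x e \<subseteq> C n"
    by (metis ex_in_conv mem_interior)
  have "norm T \<le> 4 * real n / e" if "T \<in> A" for T
  proof (rule norm_blinfun_bound)
    show "0 \<le> 4 * real n / e" using e by simp
    fix v
    show "norm (blinfun_apply T v) \<le> 4 * real n / e * norm v"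
    proof (cases "v = 0")
      case False
      define t where "t = e / (2 * norm v)"
      have t: "0 < t" "norm (t *\<^sub>R v) < e" using False e by (auto simp: t_def)
      then have "x + t *\<^sub>R v \<in> C n" "x \<in> C n"
        using e by (auto simp: subset_iff dist_norm)
      then have "norm (blinfun_apply T (x + t *\<^sub>R v)) \<le> n" "norm (blinfun_apply T x) \<le> n"
        using that by (auto simp: C_def)
      then have "norm (blinfun_apply T (x + t *\<^sub>R v) - blinfun_apply T x) \<le> 2 * real n"
        by (intro order_trans[OF norm_triangle_ineq4]) simp
      then have "t * norm (blinfun_apply T v) \<le> 2 * real n"
        using t(1) by (simp add: blinfun.add_right blinfun.scaleR_right)
      with e False show ?thesis by (simp add: t_def field_simps)
    qed simp
  qed
  then show ?thesis by (auto simp: bounded_iff)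
qed

section \<open>The support function\<close>

text \<open>The right-hand side forces \<open>F\<close> to be nonempty, in agreement with the supremum over the empty set
  being \<open>-\<infinity>\<close>.\<close>

lemma support_fun_eq_iff:
  "support_fun F ys = ereal s \<longleftrightarrow>
     (\<forall>v\<in>F. blinfun_apply ys v \<le> s) \<and> (\<forall>\<kappa>>0. \<exists>v\<in>F. s - \<kappa> < blinfun_apply ys v)"
proof (intro iffI conjI ballI allI impI)
  fix v assume "support_fun F ys = ereal s" "v \<in> F"
  then show "blinfun_apply ys v \<le> s"
    by (metis SUP_upper support_fun_def ereal_less_eq(3))
next
  fix \<kappa> :: real assume "support_fun F ys = ereal s" "0 < \<kappa>"
  then have "ereal (s - \<kappa>) < (SUP v\<in>F. ereal (blinfun_apply ys v))"
    by (simp add: support_fun_def)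
  then show "\<exists>v\<in>F. s - \<kappa> < blinfun_apply ys v"
    by (auto simp: less_SUP_iff)
next
  assume *: "(\<forall>v\<in>F. blinfun_apply ys v \<le> s) \<and> (\<forall>\<kappa>>0. \<exists>v\<in>F. s - \<kappa> < blinfun_apply ys v)"
  show "support_fun F ys = ereal s"
    unfolding support_fun_def
  proof (rule antisym)
    show "(SUP v\<in>F. ereal (blinfun_apply ys v)) \<le> ereal s"
      using * by (intro SUP_least) auto
    show "ereal s \<le> (SUP v\<in>F. ereal (blinfun_apply ys v))"
    proof (rule ereal_le_epsilon2)
      fix e :: real assume "0 < e"
      with * obtain v where v: "v \<in> F" "s - e < blinfun_apply ys v" by blast
      then have "ereal s \<le> ereal (blinfun_apply ys v) + ereal e" by simp
      also have "\<dots> \<le> (SUP v\<in>F. ereal (blinfun_apply ys v)) + ereal e"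
        using v(1) by (intro add_right_mono SUP_upper)
      finally show "ereal s \<le> (SUP v\<in>F. ereal (blinfun_apply ys v)) + ereal e" .
    qed
  qed
qed

lemma support_fun_le_iff:
  "support_fun F ys \<le> ereal s \<longleftrightarrow> (\<forall>v\<in>F. blinfun_apply ys v \<le> s)"
  by (simp add: support_fun_def SUP_le_iff)

lemma support_fun_finite:
  assumes "F \<noteq> {}" and "\<And>v. v \<in> F \<Longrightarrow> norm v \<le> M"
  obtains s where "support_fun F ys = ereal s" and "s \<le> norm ys * M"
proof -
  have "support_fun F ys \<le> ereal (norm ys * M)"
    unfolding support_fun_le_iff
  proof
    fix v assume "v \<in> F"
    have "blinfun_apply ys v \<le> norm ys * norm v"
      using norm_blinfun[of ys v] by simp
    also have "\<dots> \<le> norm ys * M"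
      using assms(2)[OF \<open>v \<in> F\<close>] by (intro mult_left_mono) auto
    finally show "blinfun_apply ys v \<le> norm ys * M" .
  qed
  moreover have "support_fun F ys \<noteq> -\<infinity>"
  proof -
    obtain v where "v \<in> F" using assms(1) by blast
    then have "ereal (blinfun_apply ys v) \<le> support_fun F ys"
      unfolding support_fun_def by (rule SUP_upper)
    then show ?thesis by auto
  qed
  ultimately show thesis
    using that by (cases "support_fun F ys") auto
qed

section \<open>Slopes of subgradients along the dynamics\<close>

text \<open>Along \<open>x - t *\<^sub>R v\<close> the minimal time grows at rate at most \<open>1\<close>, which bounds every
  \<open>\<epsilon>\<close>-subgradient in the direction \<open>- v\<close>.\<close>

lemma neg_le_of_eps_subdiff_minimal_time:
  assumes "convex F" and "v \<in> F" and "0 \<le> \<epsilon>"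
    and xs: "xs \<in> eps_subdiff \<epsilon> (minimal_time \<Omega> F) x"
    and a: "minimal_time \<Omega> F x = ereal a"
  shows "- blinfun_apply xs v \<le> 1 + \<epsilon> * norm v"
proof (rule field_le_epsilon)
  fix e :: real assume "0 < e"
  define \<gamma> where "\<gamma> = e / (norm v + 1)"
  have g: "0 < \<gamma>" "\<gamma> * norm v \<le> e"
    using \<open>0 < e\<close> by (auto simp: \<gamma>_def field_simps add_pos_nonneg)
  obtain \<delta> where "0 < \<delta>" and d: "\<And>u. norm (u - x) < \<delta> \<Longrightarrow>
      ereal a + ereal (blinfun_apply xs (u - x) - (\<epsilon> + \<gamma>) * norm (u - x)) \<le> minimal_time \<Omega> F u"
    using xs g(1) by (subst (asm) eps_subdiff_iff) (auto simp: a)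
  define t where "t = \<delta> / (norm v + 1)"
  have t: "0 < t" "t * norm v < \<delta>"
    using \<open>0 < \<delta>\<close> by (auto simp: t_def field_simps add_pos_nonneg)
  have "ereal a + ereal (blinfun_apply xs ((x - t *\<^sub>R v) - x) - (\<epsilon> + \<gamma>) * norm ((x - t *\<^sub>R v) - x))
      \<le> minimal_time \<Omega> F (x - t *\<^sub>R v)"
    by (rule d) (use t in simp)
  also have "\<dots> \<le> ereal a + ereal t"
    using minimal_time_diff_le[OF assms(1,2)] t(1) a by (metis less_imp_le)
  finally have "t * (- blinfun_apply xs v) \<le> t * (1 + (\<epsilon> + \<gamma>) * norm v)"
    using t(1) by (simp add: blinfun.minus_right blinfun.scaleR_right algebra_simps)
  then have "- blinfun_apply xs v \<le> 1 + (\<epsilon> + \<gamma>) * norm v"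
    using t(1) by (rule mult_left_le_imp_le)
  with g(2) show "- blinfun_apply xs v \<le> 1 + \<epsilon> * norm v + e"
    by (simp add: algebra_simps)
qed

text \<open>The limit of the rate bound for single subgradients: \<open>c0 = 1\<close> gives \<open>C_star\<close> and \<open>c0 = 0\<close> gives
  \<open>F_star_plus\<close>.\<close>

lemma neg_le_of_eps_subdiff_seq:
  assumes "convex F" and "v \<in> F"
    and \<epsilon>: "\<And>k. 0 \<le> \<epsilon> k" "\<epsilon> \<longlonglongrightarrow> 0"
    and sub: "\<And>k. xss k \<in> eps_subdiff (\<epsilon> k) (minimal_time \<Omega> F) (x k)"
    and c: "\<And>k. 0 \<le> c k" "c \<longlonglongrightarrow> c0"
    and lim: "weak_star_tendsto (\<lambda>k. c k *\<^sub>R xss k) xs"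
  shows "- blinfun_apply xs v \<le> c0"
proof -
  have le: "- blinfun_apply (c k *\<^sub>R xss k) v \<le> c k * (1 + \<epsilon> k * norm v)" for k
  proof -
    obtain a where "minimal_time \<Omega> F (x k) = ereal a"
      using sub[of k] by (rule minimal_time_real_of_eps_subdiff)
    with neg_le_of_eps_subdiff_minimal_time[OF assms(1,2) \<epsilon>(1) sub]
    have "- blinfun_apply (xss k) v \<le> 1 + \<epsilon> k * norm v" by blast
    from mult_left_mono[OF this c(1)[of k]] show ?thesis
      by (simp add: scaleR_blinfun.rep_eq)
  qed
  have "(\<lambda>k. - blinfun_apply (c k *\<^sub>R xss k) v) \<longlonglongrightarrow> - blinfun_apply xs v"
    using lim unfolding weak_star_tendsto_iff by (intro tendsto_minus) blast
  moreover have "(\<lambda>k. c k * (1 + \<epsilon> k * norm v)) \<longlonglongrightarrow> c0 * (1 + 0 * norm v)"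
    by (intro tendsto_intros c \<epsilon>)
  ultimately have "- blinfun_apply xs v \<le> c0 * (1 + 0 * norm v)"
    by (rule LIMSEQ_le) (use le in blast)
  then show ?thesis by simp
qed

lemma onesided_subdiff_subset_C_star:
  assumes "convex F"
  shows "onesided_subdiff (minimal_time \<Omega> F) xbar \<subseteq> C_star F"
proof
  fix xs assume "xs \<in> onesided_subdiff (minimal_time \<Omega> F) xbar"
  then obtain \<epsilon> x xss where *: "\<And>k. 0 \<le> \<epsilon> k" "\<epsilon> \<longlonglongrightarrow> 0"
      "\<And>k. xss k \<in> eps_subdiff (\<epsilon> k) (minimal_time \<Omega> F) (x k)" "weak_star_tendsto xss xs"
    by (auto simp: onesided_subdiff_def)
  have "- blinfun_apply xs v \<le> 1" if "v \<in> F" for v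
    by (rule neg_le_of_eps_subdiff_seq[OF assms that *(1-3), of "\<lambda>_. 1"]) (simp_all add: *(4))
  then show "xs \<in> C_star F"
    by (simp add: C_star_def one_ereal_def support_fun_le_iff uminus_blinfun.rep_eq)
qed

lemma onesided_singular_subdiff_subset_F_star_plus:
  assumes "convex F"
  shows "onesided_singular_subdiff (minimal_time \<Omega> F) xbar \<subseteq> F_star_plus F"
proof
  fix xs assume "xs \<in> onesided_singular_subdiff (minimal_time \<Omega> F) xbar"
  then obtain \<epsilon> c x xss where *: "\<And>k. 0 \<le> \<epsilon> k" "\<epsilon> \<longlonglongrightarrow> 0"
      "\<And>k. xss k \<in> eps_subdiff (\<epsilon> k) (minimal_time \<Omega> F) (x k)"
    and c: "\<And>k. 0 < c k" "c \<longlonglongrightarrow> 0" "weak_star_tendsto (\<lambda>k. c k *\<^sub>R xss k) xs"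
    by (auto simp: onesided_singular_subdiff_def)
  have "- blinfun_apply xs v \<le> 0" if "v \<in> F" for v
    by (rule neg_le_of_eps_subdiff_seq[OF assms that * less_imp_le[OF c(1)] c(2,3)])
  then show "xs \<in> F_star_plus F"
    by (simp add: F_star_plus_def)
qed

text \<open>Following an almost optimal direction \<open>f\<close> from \<open>x\<close>, the minimal time falls at almost unit rate, so
  that every \<open>\<epsilon>\<close>-subgradient at a point of positive time has slope at most about \<open>- 1\<close> along \<open>f\<close>.\<close>

lemma ex_ge_of_eps_subdiff_minimal_time:
  assumes M: "\<And>f. f \<in> F \<Longrightarrow> norm f \<le> M" "0 < M" and "0 \<le> \<epsilon>" and "0 < \<kappa>"
    and xs: "xs \<in> eps_subdiff \<epsilon> (minimal_time \<Omega> F) x"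
    and a: "minimal_time \<Omega> F x = ereal a" "0 < a"
  shows "\<exists>f\<in>F. 1 - \<epsilon> * M - \<kappa> \<le> - blinfun_apply xs f"
proof -
  define \<gamma> where "\<gamma> = \<kappa> / (1 + M)"
  have g: "0 < \<gamma>" "\<gamma> * (1 + M) = \<kappa>"
    using \<open>0 < \<kappa>\<close> M(2) by (auto simp: \<gamma>_def)
  obtain \<delta> where "0 < \<delta>" and d: "\<And>u. norm (u - x) < \<delta> \<Longrightarrow>
      ereal a + ereal (blinfun_apply xs (u - x) - (\<epsilon> + \<gamma>) * norm (u - x)) \<le> minimal_time \<Omega> F u"
    using xs g(1) by (subst (asm) eps_subdiff_iff) (auto simp: a)
  define t where "t = min a (\<delta> / (2 * M))"
  have t: "0 < t" "t \<le> a" "t * M < \<delta>"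
    using \<open>0 < \<delta>\<close> M(2) a(2) by (auto simp: t_def min_def field_simps)
  \<comment> \<open>The step length \<open>t\<close> is fixed before \<open>f\<close> is chosen, so that the optimality gap \<open>\<gamma> * t\<close> is
    small relative to \<open>t\<close>.\<close>
  have "minimal_time \<Omega> F x < ereal (a + \<gamma> * t)" using a g(1) t(1) by simp
  then obtain s f where s: "0 \<le> s" "ereal s < ereal (a + \<gamma> * t)" "f \<in> F" "x + s *\<^sub>R f \<in> \<Omega>"
      "minimal_time \<Omega> F x \<le> ereal s"
    by (rule minimal_time_lessE)
  have "t * norm f \<le> t * M" using M(1)[OF s(3)] t(1) by simp
  with t(3) have tf: "t * norm f < \<delta>" by linarith
  have "ereal a + ereal (blinfun_apply xs ((x + t *\<^sub>R f) - x) - (\<epsilon> + \<gamma>) * norm ((x + t *\<^sub>R f) - x))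
      \<le> minimal_time \<Omega> F (x + t *\<^sub>R f)"
    by (rule d) (use t tf in simp)
  also have "\<dots> \<le> ereal (s - t)"
    using s t(2) a by (intro minimal_time_le[OF _ s(3)]) (auto simp: algebra_simps)
  finally have "t * (1 - \<gamma> - (\<epsilon> + \<gamma>) * norm f) \<le> t * (- blinfun_apply xs f)"
    using t(1) s(2) by (simp add: blinfun.scaleR_right algebra_simps)
  then have "1 - \<gamma> - (\<epsilon> + \<gamma>) * norm f \<le> - blinfun_apply xs f"
    using t(1) by (rule mult_left_le_imp_le)
  moreover have "(\<epsilon> + \<gamma>) * norm f \<le> (\<epsilon> + \<gamma>) * M"
    using M(1)[OF s(3)] g(1) assms(3) by (intro mult_left_mono) auto
  ultimately have "1 - \<epsilon> * M - \<kappa> \<le> - blinfun_apply xs f"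
    using g(2) by (simp add: algebra_simps)
  with s(3) show ?thesis by blast
qed

text \<open>The lower bound \<open>1 - \<epsilon> k * M\<close> for the support function at the approximating subgradients passes to
  the limit because the support function is sequentially weak* continuous there.\<close>

lemma onesided_subdiff_subset_S_star:
  assumes "convex F" and "F \<noteq> {}" and "bounded F"
    and pos: "0 < minimal_time \<Omega> F xbar"
    and cont: "seq_weak_star_continuous_on (uminus ` onesided_subdiff (minimal_time \<Omega> F) xbar) (support_fun F)"
  shows "onesided_subdiff (minimal_time \<Omega> F) xbar \<subseteq> S_star F"
proof
  fix xs assume xs: "xs \<in> onesided_subdiff (minimal_time \<Omega> F) xbar"
  then obtain \<epsilon> x xss where *: "\<And>k. 0 \<le> \<epsilon> k" "\<epsilon> \<longlonglongrightarrow> 0"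
      "\<And>k. minimal_time \<Omega> F xbar \<le> minimal_time \<Omega> F (x k)"
      "\<And>k. xss k \<in> eps_subdiff (\<epsilon> k) (minimal_time \<Omega> F) (x k)" "weak_star_tendsto xss xs"
    by (auto simp: onesided_subdiff_def)
  obtain M where M: "0 < M" "\<And>f. f \<in> F \<Longrightarrow> norm f \<le> M"
    using assms(3) by (auto simp: bounded_pos)
  have "weak_star_tendsto (\<lambda>k. - xss k) (- xs)"
    using *(5) by (auto simp: weak_star_tendsto_iff uminus_blinfun.rep_eq intro: tendsto_minus)
  with cont xs have lim: "(\<lambda>k. support_fun F (- xss k)) \<longlonglongrightarrow> support_fun F (- xs)"
    unfolding seq_weak_star_continuous_on_def by blast
  have ge: "ereal (1 - \<epsilon> k * M) \<le> support_fun F (- xss k)" for k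
  proof (rule ereal_le_epsilon2)
    fix \<kappa> :: real assume "0 < \<kappa>"
    obtain a where a: "minimal_time \<Omega> F (x k) = ereal a"
      using *(4)[of k] by (rule minimal_time_real_of_eps_subdiff)
    have "0 < a" using less_le_trans[OF pos *(3)[of k]] a by simp
    from ex_ge_of_eps_subdiff_minimal_time[OF M(2,1) *(1) \<open>0 < \<kappa>\<close> *(4) a this]
    obtain f where f: "f \<in> F" "1 - \<epsilon> k * M - \<kappa> \<le> - blinfun_apply (xss k) f" by blast
    then have "ereal (1 - \<epsilon> k * M) \<le> ereal (blinfun_apply (- xss k) f) + ereal \<kappa>"
      by (simp add: uminus_blinfun.rep_eq)
    also have "\<dots> \<le> support_fun F (- xss k) + ereal \<kappa>"
      unfolding support_fun_def using f(1) by (intro add_right_mono SUP_upper)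
    finally show "ereal (1 - \<epsilon> k * M) \<le> support_fun F (- xss k) + ereal \<kappa>" .
  qed
  have "(\<lambda>k. 1 - \<epsilon> k * M) \<longlonglongrightarrow> 1 - 0 * M" by (intro tendsto_intros *(2))
  then have "(\<lambda>k. ereal (1 - \<epsilon> k * M)) \<longlonglongrightarrow> ereal 1" by simp
  then have "ereal 1 \<le> support_fun F (- xs)"
    using lim by (rule LIMSEQ_le) (use ge in blast)
  moreover have "support_fun F (- xs) \<le> 1"
    using onesided_subdiff_subset_C_star[OF assms(1)] xs by (auto simp: C_star_def)
  ultimately show "xs \<in> S_star F"
    by (simp add: S_star_def one_ereal_def antisym)
qed

section \<open>Subgradients are normals to the enlargement\<close>

text \<open>An almost optimal trajectory from \<open>x\<close> meets the enlargement at a point \<open>w\<close> after time about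
  \<open>a - r\<close>. Shifting the trajectory to end at a nearby \<open>u\<close> of the enlargement shows that the minimal time at
  \<open>x + (u - w)\<close> is at most its value at \<open>x\<close> plus a gap \<open>\<eta>\<close>; the subgradient inequality then says that
  \<open>xs\<close> is an \<open>\<epsilon>\<close>-normal at \<open>w\<close> up to the additive error \<open>\<eta>\<close>. As \<open>\<eta>\<close> may be taken small relative to
  the radius on which the subgradient inequality holds, Ekeland's principle moves \<open>w\<close> slightly to a point
  \<open>y\<close> where the additive error becomes an additional slope.\<close>

lemma eps_normals_near_of_eps_subdiff_minimal_time:
  fixes \<Omega> F :: "'a::banach set"
  assumes "convex F" and M: "\<And>f. f \<in> F \<Longrightarrow> norm f \<le> M" "0 < M"
    and "0 \<le> r" and "0 \<le> \<epsilon>" and "0 < \<gamma>"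
    and cl: "closed (enlargement \<Omega> F r \<inter> cball z \<rho>)"
    and xs: "xs \<in> eps_subdiff \<epsilon> (minimal_time \<Omega> F) x"
    and a: "minimal_time \<Omega> F x = ereal a" "r \<le> a"
    and near: "norm (x - z) + (a - r) * M < \<rho>"
  obtains w where "norm (w - x) \<le> (a - r) * M + \<gamma>"
    and "xs \<in> eps_normals (\<epsilon> + \<gamma>) w (enlargement \<Omega> F r)"
proof -
  let ?E = "enlargement \<Omega> F r"
  obtain \<delta> where "0 < \<delta>" and sub: "\<And>u. norm (u - x) < \<delta> \<Longrightarrow>
      ereal a + ereal (blinfun_apply xs (u - x) - (\<epsilon> + \<gamma>/2) * norm (u - x)) \<le> minimal_time \<Omega> F u"
    using xs \<open>0 < \<gamma>\<close> by (subst (asm) eps_subdiff_iff) (auto simp: a(1) dest!: spec[of _ "\<gamma>/2"])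
  define \<kappa> where "\<kappa> = \<rho> - norm (x - z) - (a - r) * M"
  define d where "d = min (\<delta> / 2) (min (\<kappa> / 2) (\<gamma> / 2))"
  have d: "0 < d" "d < \<delta>" "d \<le> \<kappa> / 2" "d \<le> \<gamma> / 2"
  proof -
    have "0 < \<kappa>" using near by (simp add: \<kappa>_def)
    with \<open>0 < \<delta>\<close> \<open>0 < \<gamma>\<close> show "0 < d" "d < \<delta>" "d \<le> \<kappa> / 2" "d \<le> \<gamma> / 2"
      unfolding d_def by (simp_all add: min_less_iff_disj)
  qed
  \<comment> \<open>The first bound keeps \<open>w\<close> close to \<open>x\<close>, the second keeps the Ekeland point
    within \<open>d / 2\<close> of \<open>w\<close>, in the interior of the ball on which the minimum is taken.\<close>
  define \<eta> where "\<eta> = min (d / M) (d * \<gamma> / 4)"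
  have \<eta>: "0 < \<eta>" "\<eta> * M \<le> d" "\<eta> \<le> d * \<gamma> / 4"
    using d \<open>0 < \<gamma>\<close> M(2) by (auto simp: \<eta>_def min_def field_simps)
  have "minimal_time \<Omega> F x < ereal (a + \<eta>)" using a \<eta>(1) by simp
  then obtain s f where s: "0 \<le> s" "ereal s < ereal (a + \<eta>)" "f \<in> F" "x + s *\<^sub>R f \<in> \<Omega>"
      "minimal_time \<Omega> F x \<le> ereal s"
    by (rule minimal_time_lessE)
  have sr: "r \<le> s" using a s(5) by simp
  define w where "w = x + (s - r) *\<^sub>R f"
  have "minimal_time \<Omega> F w \<le> ereal r"
    using s(4) by (intro minimal_time_le[OF assms(4) s(3)]) (simp add: w_def algebra_simps)
  then have wE: "w \<in> ?E" by (simp add: enlargement_def)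
  have "norm (w - x) \<le> (s - r) * M"
    using M(1)[OF s(3)] sr by (simp add: w_def mult_left_mono)
  also have "\<dots> \<le> (a + \<eta> - r) * M"
    using s(2) M(2) by (intro mult_right_mono) auto
  finally have wx: "norm (w - x) \<le> (a - r) * M + d"
    using \<eta>(2) by (simp add: algebra_simps)
  define S where "S = ?E \<inter> cball w d"
  have "cball w d \<subseteq> cball z \<rho>"
  proof
    fix u assume "u \<in> cball w d"
    then have "norm (u - w) \<le> d" by (simp add: dist_norm norm_minus_commute)
    moreover have "norm (u - z) \<le> norm (u - w) + norm (w - x) + norm (x - z)"
      using norm_triangle_ineq[of "u - w" "w - x"] norm_triangle_ineq[of "u - x" "x - z"] by simp
    ultimately have "norm (u - z) \<le> \<rho>"
      using wx d(3) \<kappa>_def by linarith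
    then show "u \<in> cball z \<rho>" by (simp add: dist_norm norm_minus_commute)
  qed
  then have "S = (?E \<inter> cball z \<rho>) \<inter> cball w d" by (auto simp: S_def)
  then have "complete S"
    using cl by (simp add: complete_eq_closed closed_Int)
  have wS: "w \<in> S" using wE d(1) by (simp add: S_def)
  \<comment> \<open>Up to the error \<open>\<eta>\<close>, \<open>w\<close> minimises \<open>g\<close> on \<open>S\<close>.\<close>
  define g where "g = (\<lambda>u. (\<epsilon> + \<gamma>/2) * norm (u - w) - blinfun_apply xs u)"
  have g_low: "g w \<le> g u + \<eta>" if "u \<in> S" for u
  proof -
    have uw: "norm (u - w) \<le> d" and uE: "minimal_time \<Omega> F u \<le> ereal r"
      using that by (auto simp: S_def dist_norm norm_minus_commute enlargement_def)
    define h where "h = u - w"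
    have "ereal a + ereal (blinfun_apply xs h - (\<epsilon> + \<gamma>/2) * norm h) \<le> minimal_time \<Omega> F (x + h)"
      using sub[of "x + h"] uw d(2) by (simp add: h_def)
    also have "x + h = u - (s - r) *\<^sub>R f" by (simp add: h_def w_def)
    also have "minimal_time \<Omega> F (u - (s - r) *\<^sub>R f) \<le> minimal_time \<Omega> F u + ereal (s - r)"
      using sr by (intro minimal_time_diff_le assms s) simp
    also have "\<dots> \<le> ereal r + ereal (s - r)"
      using uE by (rule add_right_mono)
    finally have "blinfun_apply xs h - (\<epsilon> + \<gamma>/2) * norm h \<le> \<eta>"
      using s(2) by simp
    then show ?thesis
      by (simp add: g_def h_def blinfun.diff_right)
  qed
  have "continuous_on S g"
    unfolding g_def by (intro continuous_intros)
  obtain y where y: "y \<in> S" "\<gamma>/2 * dist w y \<le> \<eta>"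
    and ymin: "\<And>u. u \<in> S \<Longrightarrow> g y \<le> g u + \<gamma>/2 * dist y u"
    using Ekeland_variational_principle[OF \<open>complete S\<close> \<open>continuous_on S g\<close> wS _ g_low, of "\<gamma>/2"]
      \<open>0 < \<gamma>\<close> by auto
  have wy: "dist w y \<le> d / 2"
  proof -
    have "\<gamma>/2 * dist w y \<le> \<gamma>/2 * (d / 2)" using y(2) \<eta>(3) by (simp add: mult.commute)
    then show ?thesis using \<open>0 < \<gamma>\<close> by simp
  qed
  show thesis
  proof (rule that[of y])
    have "norm (y - x) \<le> norm (w - x) + dist w y"
      using norm_triangle_ineq[of "w - x" "y - w"] by (simp add: dist_norm norm_minus_commute)
    with wx wy d show "norm (y - x) \<le> (a - r) * M + \<gamma>" by linarith
    show "xs \<in> eps_normals (\<epsilon> + \<gamma>) y ?E"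
      unfolding eps_normals_iff
    proof (intro conjI allI impI)
      show "y \<in> ?E" using y(1) by (simp add: S_def)
      fix \<gamma>' :: real assume "0 < \<gamma>'"
      have "blinfun_apply xs (u - y) \<le> (\<epsilon> + \<gamma> + \<gamma>') * norm (u - y)"
        if "u \<in> ?E" "norm (u - y) < d / 2" for u
      proof -
        have "dist w u \<le> dist w y + dist y u" by (rule dist_triangle)
        with that wy have "u \<in> S" by (simp add: S_def dist_norm norm_minus_commute)
        from ymin[OF this]
        have "blinfun_apply xs (u - y) \<le>
            (\<epsilon> + \<gamma>/2) * (norm (u - w) - norm (y - w)) + \<gamma>/2 * norm (u - y)"
          by (simp add: g_def blinfun.diff_right dist_norm norm_minus_commute algebra_simps)
        also have "\<dots> \<le> (\<epsilon> + \<gamma>/2) * norm (u - y) + \<gamma>/2 * norm (u - y)"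
          using norm_triangle_ineq2[of "u - w" "y - w"] \<open>0 \<le> \<epsilon>\<close> \<open>0 < \<gamma>\<close>
          by (intro add_right_mono mult_left_mono) auto
        also have "\<dots> \<le> (\<epsilon> + \<gamma> + \<gamma>') * norm (u - y)"
          using \<open>0 < \<gamma>'\<close> by (simp add: algebra_simps)
        finally show ?thesis .
      qed
      with d(1) show "\<exists>\<delta>>0. \<forall>u\<in>?E. norm (u - y) < \<delta> \<longrightarrow>
          blinfun_apply xs (u - y) \<le> (\<epsilon> + \<gamma> + \<gamma>') * norm (u - y)"
        by (intro exI[of _ "d/2"]) auto
    qed
  qed
qed

text \<open>The scalars \<open>c k\<close> treat both subdifferentials at once: \<open>c k = 1\<close> for the basic one, \<open>c k\<close> tending to
  \<open>0\<close> for the singular one. Continuity around \<open>xbar\<close> makes the enlargement closed near \<open>xbar\<close>, as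
  Ekeland's principle needs, and \<open>a k\<close> tending to \<open>r\<close> makes the base points of the normals tend to
  \<open>xbar\<close>.\<close>

lemma normal_cone_of_eps_subdiff:
  fixes \<Omega> F :: "'a::banach set"
  assumes "convex F" and "bounded F" and "0 \<le> r"
    and Txbar: "minimal_time \<Omega> F xbar = ereal r"
    and cont: "continuous_around (minimal_time \<Omega> F) xbar"
    and \<epsilon>: "\<And>k. 0 \<le> \<epsilon> k" "\<epsilon> \<longlonglongrightarrow> 0" and x: "x \<longlonglongrightarrow> xbar"
    and Tx: "(\<lambda>k. minimal_time \<Omega> F (x k)) \<longlonglongrightarrow> minimal_time \<Omega> F xbar"
      "\<And>k. minimal_time \<Omega> F xbar \<le> minimal_time \<Omega> F (x k)"
    and sub: "\<And>k. xss k \<in> eps_subdiff (\<epsilon> k) (minimal_time \<Omega> F) (x k)"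
    and c: "\<And>k. 0 \<le> c k" "c \<longlonglongrightarrow> c0"
    and lim: "weak_star_tendsto (\<lambda>k. c k *\<^sub>R xss k) xs"
  shows "xs \<in> normal_cone xbar (enlargement \<Omega> F r)"
proof -
  let ?E = "enlargement \<Omega> F r"
  obtain M where M: "0 < M" "\<And>f. f \<in> F \<Longrightarrow> norm f \<le> M"
    using assms(2) by (auto simp: bounded_pos)
  obtain U where U: "open U" "xbar \<in> U" "continuous_on U (minimal_time \<Omega> F)"
    using cont by (auto simp: continuous_around_def)
  obtain \<rho> where \<rho>: "0 < \<rho>" "cball xbar \<rho> \<subseteq> U"
    using U(1,2) by (auto simp: open_contains_cball)
  have "closed (cball xbar \<rho> \<inter> minimal_time \<Omega> F -` {..ereal r})"
    using U(3) \<rho>(2) by (intro continuous_closed_preimage) (auto intro: continuous_on_subset)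
  moreover have "cball xbar \<rho> \<inter> minimal_time \<Omega> F -` {..ereal r} = ?E \<inter> cball xbar \<rho>"
    by (auto simp: enlargement_def)
  ultimately have cl: "closed (?E \<inter> cball xbar \<rho>)" by simp
  define a where "a = (\<lambda>k. real_of_ereal (minimal_time \<Omega> F (x k)))"
  have Ta: "minimal_time \<Omega> F (x k) = ereal (a k)" for k
    using sub[of k] by (rule minimal_time_real_of_eps_subdiff) (simp add: a_def)
  have ra: "r \<le> a k" for k using Tx(2)[of k] Txbar Ta by simp
  have "a \<longlonglongrightarrow> r" using Tx(1) by (simp add: Ta Txbar)
  have "(\<lambda>k. norm (x k - xbar) + (a k - r) * M) \<longlonglongrightarrow> norm (xbar - xbar) + (r - r) * M"
    by (intro tendsto_intros x \<open>a \<longlonglongrightarrow> r\<close>)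
  then have "\<forall>\<^sub>F k in sequentially. norm (x k - xbar) + (a k - r) * M < \<rho>"
    by (rule order_tendstoD(2)) (simp add: \<rho>(1))
  then obtain N where N: "\<And>k. N \<le> k \<Longrightarrow> norm (x k - xbar) + (a k - r) * M < \<rho>"
    by (auto simp: eventually_sequentially)
  define j where "j = (\<lambda>k. k + N)"
  define \<gamma> where "\<gamma> = (\<lambda>k. inverse (real (Suc k)))"
  have "\<exists>w. norm (w - x (j k)) \<le> (a (j k) - r) * M + \<gamma> k \<and>
      xss (j k) \<in> eps_normals (\<epsilon> (j k) + \<gamma> k) w ?E" for k
  proof -
    have g: "0 < \<gamma> k" by (simp add: \<gamma>_def)
    have near: "norm (x (j k) - xbar) + (a (j k) - r) * M < \<rho>" by (rule N) (simp add: j_def)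
    obtain w where "norm (w - x (j k)) \<le> (a (j k) - r) * M + \<gamma> k"
        "xss (j k) \<in> eps_normals (\<epsilon> (j k) + \<gamma> k) w ?E"
      by (rule eps_normals_near_of_eps_subdiff_minimal_time
        [OF assms(1) M(2) M(1) assms(3) \<epsilon>(1)[of "j k"] g cl sub[of "j k"] Ta[of "j k"] ra[of "j k"] near])
    then show ?thesis by blast
  qed
  then obtain w where w: "\<And>k. norm (w k - x (j k)) \<le> (a (j k) - r) * M + \<gamma> k"
      "\<And>k. xss (j k) \<in> eps_normals (\<epsilon> (j k) + \<gamma> k) (w k) ?E"
    by metis
  have "\<gamma> \<longlonglongrightarrow> 0" unfolding \<gamma>_def by (rule LIMSEQ_inverse_real_of_nat)
  have aj: "(\<lambda>k. a (j k)) \<longlonglongrightarrow> r" unfolding j_def by (rule LIMSEQ_ignore_initial_segment[OF \<open>a \<longlonglongrightarrow> r\<close>])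
  have \<epsilon>j: "(\<lambda>k. \<epsilon> (j k)) \<longlonglongrightarrow> 0" unfolding j_def by (rule LIMSEQ_ignore_initial_segment[OF \<epsilon>(2)])
  have cj: "(\<lambda>k. c (j k)) \<longlonglongrightarrow> c0" unfolding j_def by (rule LIMSEQ_ignore_initial_segment[OF c(2)])
  have xj: "(\<lambda>k. x (j k)) \<longlonglongrightarrow> xbar" unfolding j_def by (rule LIMSEQ_ignore_initial_segment[OF x])
  have "0 \<le> c (j k) * (\<epsilon> (j k) + \<gamma> k)" for k
    using c(1) \<epsilon>(1) by (simp add: \<gamma>_def)
  moreover have "(\<lambda>k. c (j k) * (\<epsilon> (j k) + \<gamma> k)) \<longlonglongrightarrow> 0"
    using tendsto_mult[OF cj tendsto_add[OF \<epsilon>j \<open>\<gamma> \<longlonglongrightarrow> 0\<close>]] by simp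
  moreover have "w \<longlonglongrightarrow> xbar"
  proof -
    have "(\<lambda>k. (a (j k) - r) * M + \<gamma> k) \<longlonglongrightarrow> (r - r) * M + 0"
      by (intro tendsto_intros aj \<open>\<gamma> \<longlonglongrightarrow> 0\<close>)
    then have "(\<lambda>k. (a (j k) - r) * M + \<gamma> k) \<longlonglongrightarrow> 0" by simp
    then have "(\<lambda>k. w k - x (j k)) \<longlonglongrightarrow> 0"
      by (rule Lim_null_comparison[rotated]) (simp add: w(1))
    from tendsto_add[OF this xj] show ?thesis by simp
  qed
  moreover have "weak_star_tendsto (\<lambda>k. c (j k) *\<^sub>R xss (j k)) xs"
    unfolding weak_star_tendsto_iff
  proof
    fix v
    have "(\<lambda>k. blinfun_apply (c k *\<^sub>R xss k) v) \<longlonglongrightarrow> blinfun_apply xs v"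
      using lim unfolding weak_star_tendsto_iff by blast
    then show "(\<lambda>k. blinfun_apply (c (j k) *\<^sub>R xss (j k)) v) \<longlonglongrightarrow> blinfun_apply xs v"
      unfolding j_def by (rule LIMSEQ_ignore_initial_segment)
  qed
  moreover have "c (j k) *\<^sub>R xss (j k) \<in> eps_normals (c (j k) * (\<epsilon> (j k) + \<gamma> k)) (w k) ?E" for k
    by (intro eps_normals_scaleR w c)
  ultimately show ?thesis by (rule normal_coneI)
qed

lemma onesided_subdiff_subset_normal_cone:
  fixes \<Omega> F :: "'a::banach set"
  assumes "convex F" and "bounded F" and "0 \<le> r"
    and Txbar: "minimal_time \<Omega> F xbar = ereal r"
    and cont: "continuous_around (minimal_time \<Omega> F) xbar"
  shows "onesided_subdiff (minimal_time \<Omega> F) xbar \<subseteq> normal_cone xbar (enlargement \<Omega> F r)"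
    and "onesided_singular_subdiff (minimal_time \<Omega> F) xbar \<subseteq> normal_cone xbar (enlargement \<Omega> F r)"
proof -
  show "onesided_subdiff (minimal_time \<Omega> F) xbar \<subseteq> normal_cone xbar (enlargement \<Omega> F r)"
  proof
    fix xs assume "xs \<in> onesided_subdiff (minimal_time \<Omega> F) xbar"
    then obtain \<epsilon> x xss where *: "\<And>k. 0 \<le> \<epsilon> k" "\<epsilon> \<longlonglongrightarrow> 0" "x \<longlonglongrightarrow> xbar"
        "(\<lambda>k. minimal_time \<Omega> F (x k)) \<longlonglongrightarrow> minimal_time \<Omega> F xbar"
        "\<And>k. minimal_time \<Omega> F xbar \<le> minimal_time \<Omega> F (x k)"
        "\<And>k. xss k \<in> eps_subdiff (\<epsilon> k) (minimal_time \<Omega> F) (x k)" "weak_star_tendsto xss xs"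
      by (auto simp: onesided_subdiff_def)
    show "xs \<in> normal_cone xbar (enlargement \<Omega> F r)"
      by (rule normal_cone_of_eps_subdiff[OF assms *(1-6), of "\<lambda>_. 1" 1]) (simp_all add: *(7))
  qed
  show "onesided_singular_subdiff (minimal_time \<Omega> F) xbar \<subseteq> normal_cone xbar (enlargement \<Omega> F r)"
  proof
    fix xs assume "xs \<in> onesided_singular_subdiff (minimal_time \<Omega> F) xbar"
    then obtain \<epsilon> c x xss where *: "\<And>k. 0 \<le> \<epsilon> k" "\<epsilon> \<longlonglongrightarrow> 0" "x \<longlonglongrightarrow> xbar"
        "(\<lambda>k. minimal_time \<Omega> F (x k)) \<longlonglongrightarrow> minimal_time \<Omega> F xbar"
        "\<And>k. minimal_time \<Omega> F xbar \<le> minimal_time \<Omega> F (x k)"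
        "\<And>k. xss k \<in> eps_subdiff (\<epsilon> k) (minimal_time \<Omega> F) (x k)"
      and c: "\<And>k. 0 < c k" "c \<longlonglongrightarrow> 0" "weak_star_tendsto (\<lambda>k. c k *\<^sub>R xss k) xs"
      by (auto simp: onesided_singular_subdiff_def)
    show "xs \<in> normal_cone xbar (enlargement \<Omega> F r)"
      by (rule normal_cone_of_eps_subdiff[OF assms * less_imp_le[OF c(1)] c(2,3)])
  qed
qed

section \<open>Normals to the enlargement are multiples of subgradients\<close>

text \<open>From \<open>u\<close> near \<open>x\<close> move to a point \<open>w\<close> of the enlargement at distance at most about
  \<open>(1 + L * M) * norm (u - x)\<close> from \<open>x\<close>, and use the normal inequality there. If the minimal time at
  \<open>u\<close> is at least \<open>r\<close>, \<open>w\<close> lies forward along an almost optimal direction, and \<open>support_fun F (- xs) \<le> 1\<close>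
  controls the error. If it is \<open>r - \<tau>\<close>, then \<open>w = u - \<tau> *\<^sub>R v\<close> lies in the enlargement for each \<open>v\<close> in
  \<open>F\<close>, and \<open>support_fun F (- xs) \<ge> 1\<close> supplies \<open>v\<close> with
  \<open>- blinfun_apply xs v\<close> arbitrarily close to \<open>1\<close>.\<close>

lemma eps_subdiff_minimal_time_of_eps_normals:
  assumes "convex F" and M: "\<And>f. f \<in> F \<Longrightarrow> norm f \<le> M" "0 < M"
    and "0 \<le> r" and "0 \<le> \<epsilon>" and "0 \<le> L" and "0 < \<rho>"
    and xs: "xs \<in> eps_normals \<epsilon> x (enlargement \<Omega> F r)"
    and Tx: "minimal_time \<Omega> F x = ereal r"
    and lip: "\<And>u. norm (u - x) < \<rho> \<Longrightarrow>
      \<exists>b. minimal_time \<Omega> F u = ereal b \<and> \<bar>b - r\<bar> \<le> L * norm (u - x)"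
    and supp: "support_fun F (- xs) = 1"
  shows "xs \<in> eps_subdiff ((1 + L * M) * \<epsilon>) (minimal_time \<Omega> F) x"
proof -
  let ?E = "enlargement \<Omega> F r"
  have le1: "- blinfun_apply xs v \<le> 1" if "v \<in> F" for v
    using supp that support_fun_eq_iff[of F "- xs" 1] by (simp add: one_ereal_def uminus_blinfun.rep_eq)
  have ge1: "\<exists>v\<in>F. 1 - \<kappa> < - blinfun_apply xs v" if "0 < \<kappa>" for \<kappa>
    using supp that support_fun_eq_iff[of F "- xs" 1] by (simp add: one_ereal_def uminus_blinfun.rep_eq)
  define K where "K = 1 + L * M"
  have K: "1 \<le> K" using M(2) \<open>0 \<le> L\<close> by (simp add: K_def)
  have "\<exists>\<delta>>0. \<forall>u. norm (u - x) < \<delta> \<longrightarrow>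
      ereal r + ereal (blinfun_apply xs (u - x) - (K * \<epsilon> + \<gamma>) * norm (u - x)) \<le> minimal_time \<Omega> F u"
    if "0 < \<gamma>" for \<gamma>
  proof -
    define g where "g = \<epsilon> + \<gamma> / K"
    have g: "0 < g" "K * g = K * \<epsilon> + \<gamma>"
      using K that \<open>0 \<le> \<epsilon>\<close> by (auto simp: g_def add_nonneg_pos distrib_left)
    have "0 < \<gamma> / K" using K that by simp
    with xs obtain \<delta> where "0 < \<delta>" and nrm: "\<And>w. w \<in> ?E \<Longrightarrow> norm (w - x) < \<delta> \<Longrightarrow>
        blinfun_apply xs (w - x) \<le> g * norm (w - x)"
      by (auto simp: eps_normals_iff g_def)
    have "ereal r + ereal (blinfun_apply xs (u - x) - (K * \<epsilon> + \<gamma>) * norm (u - x)) \<le> minimal_time \<Omega> F u"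
      if u: "norm (u - x) < min \<rho> (\<delta> / K)" for u
    proof -
      define n where "n = norm (u - x)"
      have Kn: "0 \<le> n" "K * n < \<delta>" using u K by (auto simp: n_def field_simps)
      obtain b where b: "minimal_time \<Omega> F u = ereal b" "\<bar>b - r\<bar> \<le> L * n"
        using lip[of u] u by (auto simp: n_def)
      have dist_bound: "norm (u + t *\<^sub>R f - x) \<le> n + \<bar>t\<bar> * M" if "f \<in> F" for t f
      proof -
        have "norm (u + t *\<^sub>R f - x) \<le> norm (u - x) + norm (t *\<^sub>R f)"
          using norm_triangle_ineq[of "u - x" "t *\<^sub>R f"] by (simp add: algebra_simps)
        also have "norm (t *\<^sub>R f) \<le> \<bar>t\<bar> * M"
          using M(1)[OF that] by (simp add: mult_left_mono)
        finally show ?thesis by (simp add: n_def)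
      qed
      have split: "blinfun_apply xs (u + t *\<^sub>R f - x) = blinfun_apply xs (u - x) + t * blinfun_apply xs f"
        for t f by (simp add: blinfun.diff_right blinfun.add_right blinfun.scaleR_right)
      have "blinfun_apply xs (u - x) - K * g * n \<le> b - r"
      proof (cases "r \<le> b")
        case True
        show ?thesis
        proof (rule field_le_epsilon)
          fix e :: real assume "0 < e"
          \<comment> \<open>The first bound makes the final error at most \<open>e\<close>, the second keeps the point \<open>?w\<close> where
            \<open>nrm\<close> applies.\<close>
          define \<eta> where "\<eta> = min (e / (1 + g * M)) ((\<delta> - K * n) / (2 * M))"
          have gM: "0 < 1 + g * M" using g(1) M(2) by (simp add: add_pos_pos)
          have "0 < \<eta>" unfolding \<eta>_def using \<open>0 < e\<close> gM Kn M(2) by simp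
          have \<eta>1: "\<eta> * (1 + g * M) \<le> e"
            using gM by (simp add: \<eta>_def pos_le_divide_eq[symmetric])
          have "\<eta> * (2 * M) \<le> \<delta> - K * n"
            using M(2) by (subst pos_le_divide_eq[symmetric]) (auto simp: \<eta>_def)
          moreover have "0 < \<eta> * M" using \<open>0 < \<eta>\<close> M(2) by simp
          ultimately have \<eta>2: "K * n + \<eta> * M < \<delta>" by linarith
          have "minimal_time \<Omega> F u < ereal (b + \<eta>)" using b \<open>0 < \<eta>\<close> by simp
          then obtain s f where s: "0 \<le> s" "ereal s < ereal (b + \<eta>)" "f \<in> F" "u + s *\<^sub>R f \<in> \<Omega>"
              "minimal_time \<Omega> F u \<le> ereal s"
            by (rule minimal_time_lessE)
          have sr: "r \<le> s" using s(5) b True by simp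
          let ?w = "u + (s - r) *\<^sub>R f"
          have "minimal_time \<Omega> F ?w \<le> ereal r"
            using s(4) by (intro minimal_time_le[OF assms(4) s(3)]) (simp add: algebra_simps)
          then have wE: "?w \<in> ?E" by (simp add: enlargement_def)
          have "(s - r) * M \<le> (L * n + \<eta>) * M"
            using b(2) s(2) M(2) by (intro mult_right_mono) auto
          then have w: "norm (?w - x) \<le> K * n + \<eta> * M"
            using dist_bound[OF s(3), of "s - r"] sr by (simp add: K_def algebra_simps)
          have "blinfun_apply xs (u - x) + (s - r) * blinfun_apply xs f \<le> g * norm (?w - x)"
            using nrm[OF wE] w \<eta>2 by (simp only: split)
          also have "\<dots> \<le> g * (K * n + \<eta> * M)"
            using w g(1) by (intro mult_left_mono) auto
          finally have *: "blinfun_apply xs (u - x) + (s - r) * blinfun_apply xs f \<le> g * (K * n + \<eta> * M)" .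
          have "(s - r) * (- blinfun_apply xs f) \<le> (s - r) * 1"
            using sr le1[OF s(3)] by (intro mult_left_mono) auto
          then have "blinfun_apply xs (u - x) \<le> g * (K * n + \<eta> * M) + (b + \<eta> - r)"
            using * s(2) by simp
          with \<eta>1 show "blinfun_apply xs (u - x) - K * g * n \<le> b - r + e"
            by (simp add: algebra_simps)
        qed
      next
        case False
        define \<tau> where "\<tau> = r - b"
        have \<tau>: "0 < \<tau>" "\<tau> \<le> L * n" using False b(2) by (auto simp: \<tau>_def)
        show ?thesis
        proof (rule field_le_epsilon)
          fix e :: real assume "0 < e"
          then obtain v where v: "v \<in> F" "1 - e / \<tau> < - blinfun_apply xs v"
            using ge1[of "e / \<tau>"] \<tau>(1) by auto
          let ?w = "u + (- \<tau>) *\<^sub>R v"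
          have "minimal_time \<Omega> F (u - \<tau> *\<^sub>R v) \<le> minimal_time \<Omega> F u + ereal \<tau>"
            using \<tau>(1) by (intro minimal_time_diff_le assms(1) v(1)) simp
          moreover have "u - \<tau> *\<^sub>R v = ?w" by simp
          ultimately have wE: "?w \<in> ?E" using b(1) by (simp only: enlargement_def) (simp add: \<tau>_def)
          have "\<tau> * M \<le> (L * n) * M" using \<tau>(2) M(2) by (intro mult_right_mono) auto
          then have w: "norm (?w - x) \<le> K * n"
            using dist_bound[OF v(1), of "- \<tau>"] \<tau>(1) by (simp add: K_def algebra_simps)
          have "blinfun_apply xs (u - x) + (- \<tau>) * blinfun_apply xs v \<le> g * norm (?w - x)"
            using nrm[OF wE] w Kn by (simp only: split)
          also have "\<dots> \<le> g * (K * n)"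
            using w g(1) by (intro mult_left_mono) auto
          finally have *: "blinfun_apply xs (u - x) + (- \<tau>) * blinfun_apply xs v \<le> g * (K * n)" .
          have "\<tau> * (1 - e / \<tau>) \<le> \<tau> * (- blinfun_apply xs v)"
            using \<tau>(1) v(2) by (intro mult_left_mono) auto
          then have "\<tau> - e \<le> - (\<tau> * blinfun_apply xs v)"
            using \<tau>(1) by (simp add: right_diff_distrib)
          with * show "blinfun_apply xs (u - x) - K * g * n \<le> b - r + e"
            by (simp add: \<tau>_def algebra_simps)
        qed
      qed
      then show ?thesis using b(1) g(2) by (simp add: n_def)
    qed
    moreover have "0 < min \<rho> (\<delta> / K)" using \<open>0 < \<rho>\<close> \<open>0 < \<delta>\<close> K by simp
    ultimately show ?thesis by blast
  qed
  then show ?thesis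
    by (subst eps_subdiff_iff) (simp_all add: Tx K_def)
qed

text \<open>Dividing the \<open>\<epsilon>\<close>-normals by \<open>\<sigma> k\<close> normalises the support function to \<open>1\<close>, as required for them to be
  subgradients. This needs base points of time exactly \<open>r\<close>: at a point of smaller time the enlargement
  has interior, so that the \<open>\<epsilon>\<close>-normal would have norm at most \<open>\<epsilon> k\<close> and \<open>\<sigma> k\<close> could not stay
  away from \<open>0\<close>. Only the limit \<open>\<alpha>\<close> of the \<open>\<sigma> k\<close> enters, which need not be the support function
  at the limit \<open>xs\<close>.\<close>

lemma onesided_subdiff_of_eps_normals:
  assumes "convex F" and "F \<noteq> {}" and "bounded F" and "0 \<le> r"
    and Txbar: "minimal_time \<Omega> F xbar = ereal r"
    and lip: "locally_lipschitz_around (minimal_time \<Omega> F) xbar"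
    and \<epsilon>: "\<And>k. 0 \<le> \<epsilon> k" "\<epsilon> \<longlonglongrightarrow> 0" and x: "x \<longlonglongrightarrow> xbar" and xss: "weak_star_tendsto xss xs"
    and nrm: "\<And>k. xss k \<in> eps_normals (\<epsilon> k) (x k) (enlargement \<Omega> F r)"
    and \<sigma>: "\<And>k. support_fun F (- xss k) = ereal (\<sigma> k)" "\<sigma> \<longlonglongrightarrow> \<alpha>" "0 < \<alpha>"
  shows "(1 / \<alpha>) *\<^sub>R xs \<in> onesided_subdiff (minimal_time \<Omega> F) xbar"
proof -
  let ?E = "enlargement \<Omega> F r"
  obtain M where M: "0 < M" "\<And>f. f \<in> F \<Longrightarrow> norm f \<le> M"
    using assms(3) by (auto simp: bounded_pos)
  obtain U L where U: "open U" "xbar \<in> U" "\<And>u. u \<in> U \<Longrightarrow> \<bar>minimal_time \<Omega> F u\<bar> \<noteq> \<infinity>"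
    and L: "L-lipschitz_on U (\<lambda>u. real_of_ereal (minimal_time \<Omega> F u))"
    using lip by (auto simp: locally_lipschitz_around_def)
  have "0 \<le> L" using L by (rule lipschitz_on_nonneg)
  obtain \<rho>' where \<rho>': "0 < \<rho>'" "ball xbar \<rho>' \<subseteq> U"
    using U(1,2) by (auto simp: open_contains_ball)
  define \<rho> where "\<rho> = \<rho>' / 2"
  have \<rho>: "0 < \<rho>" using \<rho>' by (simp add: \<rho>_def)
  have near: "\<exists>b. minimal_time \<Omega> F u = ereal b \<and> \<bar>b - a\<bar> \<le> L * norm (u - y)"
    if "norm (y - xbar) < \<rho>" "norm (u - y) < \<rho>" "minimal_time \<Omega> F y = ereal a" for u y a
  proof -
    have "norm (u - xbar) < \<rho>'" 
      using norm_triangle_ineq[of "u - y" "y - xbar"] that by (simp add: \<rho>_def)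
    then have "u \<in> U" "y \<in> U"
      using \<rho>' that by (auto simp: subset_iff dist_norm norm_minus_commute \<rho>_def)
    moreover obtain b where "minimal_time \<Omega> F u = ereal b"
      using U(3)[OF \<open>u \<in> U\<close>] by auto
    ultimately show ?thesis
      using lipschitz_onD[OF L \<open>u \<in> U\<close> \<open>y \<in> U\<close>] that(3) by (simp add: dist_norm)
  qed
  have "\<forall>\<^sub>F k in sequentially. \<alpha> / 2 < \<sigma> k"
    using \<sigma>(2,3) by (intro order_tendstoD(1)[OF \<sigma>(2)]) simp
  moreover have "\<forall>\<^sub>F k in sequentially. \<epsilon> k * M < \<alpha> / 2"
    using tendsto_mult_right[OF \<epsilon>(2), of M] \<sigma>(3)
    by (intro order_tendstoD(2)[of "\<lambda>k. \<epsilon> k * M" 0]) simp_all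
  moreover have "\<forall>\<^sub>F k in sequentially. norm (x k - xbar) < \<rho>"
    using tendstoD[OF x \<rho>] by (simp add: dist_norm)
  ultimately have "\<forall>\<^sub>F k in sequentially. \<alpha> / 2 < \<sigma> k \<and> \<epsilon> k * M < \<alpha> / 2 \<and> norm (x k - xbar) < \<rho>"
    by (intro eventually_conj)
  then obtain N where N: "\<And>k. N \<le> k \<Longrightarrow> \<alpha> / 2 < \<sigma> k" "\<And>k. N \<le> k \<Longrightarrow> \<epsilon> k * M < \<alpha> / 2"
      "\<And>k. N \<le> k \<Longrightarrow> norm (x k - xbar) < \<rho>"
    by (auto simp: eventually_sequentially)
  have Tx: "minimal_time \<Omega> F (x k) = ereal r" if kN: "N \<le> k" for k
  proof (rule ccontr)
    assume neq: "minimal_time \<Omega> F (x k) \<noteq> ereal r"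
    have "minimal_time \<Omega> F (x k) \<le> ereal r"
      using nrm[of k] by (simp add: eps_normals_iff enlargement_def)
    moreover obtain a where a: "minimal_time \<Omega> F (x k) = ereal a"
      using near[of xbar "x k" r] N(3)[OF kN] Txbar \<rho> by auto
    ultimately have "a < r" using neq by simp
    \<comment> \<open>\<open>L\<close> may be \<open>0\<close>, hence the denominator \<open>L + 1\<close>.\<close>
    define d where "d = min \<rho> ((r - a) / (L + 1))"
    have "0 < d" using \<rho> \<open>a < r\<close> \<open>0 \<le> L\<close> by (simp add: d_def)
    moreover have "ball (x k) d \<subseteq> ?E"
    proof
      fix u assume "u \<in> ball (x k) d"
      then have u: "norm (u - x k) < \<rho>" "norm (u - x k) \<le> (r - a) / (L + 1)"
        by (auto simp: d_def dist_norm norm_minus_commute)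
      obtain b where b: "minimal_time \<Omega> F u = ereal b" "\<bar>b - a\<bar> \<le> L * norm (u - x k)"
        using near[OF N(3)[OF kN] u(1) a] by blast
      have "L * norm (u - x k) \<le> (L + 1) * norm (u - x k)"
        by (simp add: mult_right_mono)
      also have "\<dots> \<le> r - a"
        using u(2) \<open>0 \<le> L\<close> by (simp add: field_simps)
      finally show "u \<in> ?E" using b by (simp add: enlargement_def)
    qed
    ultimately have "x k \<in> interior ?E" by (auto simp: mem_interior)
    then have "norm (xss k) \<le> \<epsilon> k"
      using norm_le_of_eps_normals_interior nrm \<epsilon>(1) by blast
    obtain s where "support_fun F (- xss k) = ereal s" "s \<le> norm (- xss k) * M"
      using support_fun_finite[OF assms(2) M(2)] by blast
    then have "\<sigma> k \<le> norm (xss k) * M" using \<sigma>(1)[of k] by simp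
    also have "\<dots> \<le> \<epsilon> k * M" using \<open>norm (xss k) \<le> \<epsilon> k\<close> M(1) by (intro mult_right_mono) auto
    finally show False using N(1,2)[OF kN] by linarith
  qed
  define j where "j = (\<lambda>k. k + N)"
  have jN: "N \<le> j k" for k by (simp add: j_def)
  have \<sigma>pos: "0 < \<sigma> (j k)" for k using N(1)[OF jN[of k]] \<sigma>(3) by linarith
  define \<epsilon>' where "\<epsilon>' = (\<lambda>k. (1 + L * M) * (1 / \<sigma> (j k) * \<epsilon> (j k)))"
  define yss where "yss = (\<lambda>k. (1 / \<sigma> (j k)) *\<^sub>R xss (j k))"
  have \<sigma>j: "(\<lambda>k. \<sigma> (j k)) \<longlonglongrightarrow> \<alpha>" unfolding j_def by (rule LIMSEQ_ignore_initial_segment[OF \<sigma>(2)])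
  have \<epsilon>j: "(\<lambda>k. \<epsilon> (j k)) \<longlonglongrightarrow> 0" unfolding j_def by (rule LIMSEQ_ignore_initial_segment[OF \<epsilon>(2)])
  have xj: "(\<lambda>k. x (j k)) \<longlonglongrightarrow> xbar" unfolding j_def by (rule LIMSEQ_ignore_initial_segment[OF x])
  have xssj: "(\<lambda>k. blinfun_apply (xss (j k)) v) \<longlonglongrightarrow> blinfun_apply xs v" for v
    unfolding j_def using xss[unfolded weak_star_tendsto_iff] by (intro LIMSEQ_ignore_initial_segment) blast
  have "minimal_time \<Omega> F xbar < \<infinity>" using Txbar by simp
  moreover have "0 \<le> \<epsilon>' k" for k
    using \<epsilon>(1) \<open>0 \<le> L\<close> M(1) \<sigma>pos[of k] by (simp add: \<epsilon>'_def)
  moreover have "\<epsilon>' \<longlonglongrightarrow> 0"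
  proof -
    have "\<epsilon>' \<longlonglongrightarrow> (1 + L * M) * (1 / \<alpha> * 0)"
      unfolding \<epsilon>'_def using \<sigma>(3) by (intro tendsto_intros \<sigma>j \<epsilon>j) simp
    then show ?thesis by simp
  qed
  moreover note xj
  moreover have "minimal_time \<Omega> F (x (j k)) = minimal_time \<Omega> F xbar" for k
    using Tx jN Txbar by simp
  moreover have "yss k \<in> eps_subdiff (\<epsilon>' k) (minimal_time \<Omega> F) (x (j k))" for k
    unfolding \<epsilon>'_def
  proof (rule eps_subdiff_minimal_time_of_eps_normals[OF assms(1) M(2,1) assms(4) _ \<open>0 \<le> L\<close> \<rho>])
    show "0 \<le> 1 / \<sigma> (j k) * \<epsilon> (j k)" using \<epsilon>(1) \<sigma>pos[of k] by simp
    show "yss k \<in> eps_normals (1 / \<sigma> (j k) * \<epsilon> (j k)) (x (j k)) ?E"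
      unfolding yss_def using \<sigma>pos[of k] by (intro eps_normals_scaleR nrm) simp
    show "minimal_time \<Omega> F (x (j k)) = ereal r" using Tx jN by simp
    then show "\<exists>b. minimal_time \<Omega> F u = ereal b \<and> \<bar>b - r\<bar> \<le> L * norm (u - x (j k))"
      if "norm (u - x (j k)) < \<rho>" for u
      using near[OF N(3)[OF jN] that] by simp
    have s: "\<forall>v\<in>F. blinfun_apply (- xss (j k)) v \<le> \<sigma> (j k)"
      "\<And>\<kappa>. 0 < \<kappa> \<Longrightarrow> \<exists>v\<in>F. \<sigma> (j k) - \<kappa> < blinfun_apply (- xss (j k)) v"
      using \<sigma>(1)[of "j k"] unfolding support_fun_eq_iff by blast+
    have yv: "blinfun_apply (- yss k) v = blinfun_apply (- xss (j k)) v / \<sigma> (j k)" for v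
      by (simp add: yss_def uminus_blinfun.rep_eq scaleR_blinfun.rep_eq)
    have "support_fun F (- yss k) = ereal 1"
      unfolding support_fun_eq_iff yv
    proof (intro conjI ballI allI impI)
      fix v assume "v \<in> F"
      with s(1) \<sigma>pos[of k] show "blinfun_apply (- xss (j k)) v / \<sigma> (j k) \<le> 1" by simp
    next
      fix \<kappa> :: real assume "0 < \<kappa>"
      then obtain v where "v \<in> F" "\<sigma> (j k) - \<kappa> * \<sigma> (j k) < blinfun_apply (- xss (j k)) v"
        using s(2)[of "\<kappa> * \<sigma> (j k)"] \<sigma>pos[of k] by auto
      then show "\<exists>v\<in>F. 1 - \<kappa> < blinfun_apply (- xss (j k)) v / \<sigma> (j k)"
        using \<sigma>pos[of k] by (intro bexI[of _ v]) (auto simp: field_simps)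
    qed
    then show "support_fun F (- yss k) = 1" by (simp add: one_ereal_def)
  qed
  moreover have "weak_star_tendsto yss ((1 / \<alpha>) *\<^sub>R xs)"
    unfolding weak_star_tendsto_iff
  proof
    fix v
    have "(\<lambda>k. 1 / \<sigma> (j k) * blinfun_apply (xss (j k)) v) \<longlonglongrightarrow> 1 / \<alpha> * blinfun_apply xs v"
      using \<sigma>(3) by (intro tendsto_intros \<sigma>j xssj) simp
    then show "(\<lambda>k. blinfun_apply (yss k) v) \<longlonglongrightarrow> blinfun_apply ((1 / \<alpha>) *\<^sub>R xs) v"
      by (simp add: yss_def scaleR_blinfun.rep_eq)
  qed
  ultimately show ?thesis by (rule onesided_subdiffI)
qed

lemma normal_cone_Int_S_star_subset_onesided_subdiff:
  assumes "convex F" and "F \<noteq> {}" and "bounded F" and "0 \<le> r"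
    and Txbar: "minimal_time \<Omega> F xbar = ereal r"
    and lip: "locally_lipschitz_around (minimal_time \<Omega> F) xbar"
    and cont: "seq_weak_star_continuous_on
      (uminus ` (normal_cone xbar (enlargement \<Omega> F r) \<inter> S_star F)) (support_fun F)"
  shows "normal_cone xbar (enlargement \<Omega> F r) \<inter> S_star F \<subseteq> onesided_subdiff (minimal_time \<Omega> F) xbar"
proof
  fix xs assume xs: "xs \<in> normal_cone xbar (enlargement \<Omega> F r) \<inter> S_star F"
  then obtain \<epsilon> x xss where *: "\<And>k. 0 \<le> \<epsilon> k" "\<epsilon> \<longlonglongrightarrow> 0" "x \<longlonglongrightarrow> xbar" "weak_star_tendsto xss xs"
      "\<And>k. xss k \<in> eps_normals (\<epsilon> k) (x k) (enlargement \<Omega> F r)"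
    by (auto simp: normal_cone_def)
  obtain M where M: "\<And>f. f \<in> F \<Longrightarrow> norm f \<le> M"
    using assms(3) by (auto simp: bounded_iff)
  have "\<exists>s. support_fun F (- xss k) = ereal s" for k
    by (rule support_fun_finite[OF assms(2) M]) blast+
  then obtain \<sigma> where \<sigma>: "\<And>k. support_fun F (- xss k) = ereal (\<sigma> k)" by metis
  have "weak_star_tendsto (\<lambda>k. - xss k) (- xs)"
    using *(4) by (auto simp: weak_star_tendsto_iff uminus_blinfun.rep_eq intro: tendsto_minus)
  with cont xs have "(\<lambda>k. support_fun F (- xss k)) \<longlonglongrightarrow> support_fun F (- xs)"
    unfolding seq_weak_star_continuous_on_def by blast
  moreover have "support_fun F (- xs) = ereal 1"
    using xs by (simp add: S_star_def one_ereal_def)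
  ultimately have "\<sigma> \<longlonglongrightarrow> 1" by (simp add: \<sigma>)
  from onesided_subdiff_of_eps_normals[OF assms(1-4) Txbar lip * \<sigma> this]
  show "xs \<in> onesided_subdiff (minimal_time \<Omega> F) xbar" by simp
qed

text \<open>The support function need not be sequentially weak* continuous, but its values \<open>\<sigma> k\<close> at the
  approximating normals are bounded by the Banach--Steinhaus theorem. A subsequence converges to some
  \<open>\<alpha>\<close>, and \<open>\<alpha>\<close> is positive because \<open>\<sigma> k\<close> is at least the value of \<open>- xss k\<close> at a direction \<open>v0\<close> of \<open>F\<close>
  on which \<open>xs\<close> is negative; such \<open>v0\<close> exists as \<open>F\<close> contains a ball around \<open>0\<close>. Then \<open>xs\<close> divided by \<open>\<alpha>\<close>
  is a one-sided subgradient.\<close>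

lemma normal_cone_subset_scaled_onesided_subdiff:
  fixes \<Omega> F :: "'a::banach set"
  assumes "convex F" and "bounded F" and "0 \<le> r" and "0 \<in> interior F"
    and Txbar: "minimal_time \<Omega> F xbar = ereal r"
    and xs: "xs \<in> normal_cone xbar (enlargement \<Omega> F r)" "xs \<noteq> 0"
  obtains \<alpha> ys where "0 < \<alpha>" and "ys \<in> onesided_subdiff (minimal_time \<Omega> F) xbar" and "xs = \<alpha> *\<^sub>R ys"
proof -
  have "F \<noteq> {}" using assms(4) by auto
  have lip: "locally_lipschitz_around (minimal_time \<Omega> F) xbar"
    by (rule locally_lipschitz_minimal_time[OF assms(1,4)]) (simp add: Txbar)
  obtain \<epsilon> x xss where *: "\<And>k. 0 \<le> \<epsilon> k" "\<epsilon> \<longlonglongrightarrow> 0" "x \<longlonglongrightarrow> xbar" "weak_star_tendsto xss xs"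
      "\<And>k. xss k \<in> eps_normals (\<epsilon> k) (x k) (enlargement \<Omega> F r)"
    using xs(1) by (auto simp: normal_cone_def)
  have lim: "(\<lambda>k. blinfun_apply (xss k) v) \<longlonglongrightarrow> blinfun_apply xs v" for v
    using *(4) by (simp add: weak_star_tendsto_iff)
  obtain M where M: "0 < M" "\<And>f. f \<in> F \<Longrightarrow> norm f \<le> M"
    using assms(2) by (auto simp: bounded_pos)
  have "\<exists>s. support_fun F (- xss k) = ereal s \<and> s \<le> norm (- xss k) * M" for k
    by (rule support_fun_finite[OF \<open>F \<noteq> {}\<close> M(2)]) blast+
  then obtain \<sigma> where \<sigma>: "\<And>k. support_fun F (- xss k) = ereal (\<sigma> k)" "\<And>k. \<sigma> k \<le> norm (xss k) * M"
    by (metis norm_minus_cancel)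
  obtain v0 where v0: "v0 \<in> F" "blinfun_apply xs v0 < 0"
  proof -
    obtain u where u: "blinfun_apply xs u \<noteq> 0"
      using xs(2) by (metis blinfun_eqI zero_blinfun.rep_eq)
    define w where "w = (if blinfun_apply xs u < 0 then u else - u)"
    have w: "blinfun_apply xs w < 0" "w \<noteq> 0"
      using u by (auto simp: w_def blinfun.minus_right blinfun.zero_right)
    obtain d where d: "0 < d" "cball 0 d \<subseteq> F"
      using assms(4) by (metis mem_interior_cball)
    show thesis
    proof (rule that)
      show "(d / norm w) *\<^sub>R w \<in> F"
        using d w(2) by (intro subsetD[OF d(2)]) simp
      show "blinfun_apply xs ((d / norm w) *\<^sub>R w) < 0"
        using mult_pos_neg[of "d / norm w" "blinfun_apply xs w"] d(1) w
        by (simp only: blinfun.scaleR_right real_scaleR_def divide_pos_pos zero_less_norm_iff simp_thms)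
    qed
  qed
  have low: "- blinfun_apply (xss k) v0 \<le> \<sigma> k" for k
    using \<sigma>(1)[of k] v0(1) by (simp add: support_fun_eq_iff uminus_blinfun.rep_eq)
  have "bounded (range xss)"
  proof (rule bounded_family_of_pointwise_bounded)
    fix v
    have "bounded (range (\<lambda>k. blinfun_apply (xss k) v))"
      using lim by (rule convergent_imp_bounded)
    then show "bounded ((\<lambda>T. blinfun_apply T v) ` range xss)"
      by (simp add: image_image)
  qed
  then obtain B where B: "\<And>k. norm (xss k) \<le> B"
    by (auto simp: bounded_iff)
  have up: "\<sigma> k \<le> B * M" for k
    using \<sigma>(2)[of k] mult_right_mono[OF B[of k], of M] M(1) by linarith
  have "bounded (range (\<lambda>k. - blinfun_apply (xss k) v0))"
    using tendsto_minus[OF lim] by (rule convergent_imp_bounded)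
  then obtain b where b: "\<And>k. \<bar>blinfun_apply (xss k) v0\<bar> \<le> b"
    by (auto simp: bounded_iff)
  have "bounded (range \<sigma>)"
    unfolding bounded_iff
  proof (intro exI ballI)
    fix s assume "s \<in> range \<sigma>"
    then obtain k where "s = \<sigma> k" by blast
    with low[of k] up[of k] b[of k] show "norm s \<le> \<bar>B * M\<bar> + b" by simp
  qed
  then obtain \<alpha> j where j: "strict_mono j" "(\<sigma> \<circ> j) \<longlonglongrightarrow> \<alpha>"
    using bounded_imp_convergent_subsequence by blast
  have "- blinfun_apply xs v0 \<le> \<alpha>"
  proof (rule LIMSEQ_le)
    show "((\<lambda>k. - blinfun_apply (xss k) v0) \<circ> j) \<longlonglongrightarrow> - blinfun_apply xs v0"
      by (rule LIMSEQ_subseq_LIMSEQ[OF tendsto_minus[OF lim] j(1)])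
  qed (use low j(2) in auto)
  with v0(2) have "0 < \<alpha>" by linarith
  have "weak_star_tendsto (xss \<circ> j) xs"
    unfolding weak_star_tendsto_iff using LIMSEQ_subseq_LIMSEQ[OF lim j(1)] by (simp add: comp_def)
  moreover have "(\<epsilon> \<circ> j) \<longlonglongrightarrow> 0" "(x \<circ> j) \<longlonglongrightarrow> xbar"
    by (rule LIMSEQ_subseq_LIMSEQ[OF *(2) j(1)], rule LIMSEQ_subseq_LIMSEQ[OF *(3) j(1)])
  ultimately have "(1 / \<alpha>) *\<^sub>R xs \<in> onesided_subdiff (minimal_time \<Omega> F) xbar"
    using onesided_subdiff_of_eps_normals
      [OF assms(1) \<open>F \<noteq> {}\<close> assms(2,3) Txbar lip, of "\<epsilon> \<circ> j" "x \<circ> j" "xss \<circ> j" xs "\<sigma> \<circ> j" \<alpha>]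
      * \<sigma>(1) j(2) \<open>0 < \<alpha>\<close> by simp
  with \<open>0 < \<alpha>\<close> show thesis by (intro that[of \<alpha> "(1 / \<alpha>) *\<^sub>R xs"]) simp_all
qed

section \<open>Subdifferentials through normals to the enlargement\<close>

theorem theorem6p5:
  fixes \<Omega> F :: "'a::banach set" and xbar :: 'a and r :: real
  assumes "\<Omega> \<noteq> {}" and "closed \<Omega>"
    and "F \<noteq> {}" and "closed F" and "bounded F" and "convex F"
    and "xbar \<notin> \<Omega>" and "minimal_time \<Omega> F xbar = ereal r"
    and "continuous_around (minimal_time \<Omega> F) xbar"
  shows "onesided_subdiff (minimal_time \<Omega> F) xbar
           \<subseteq> normal_cone xbar (enlargement \<Omega> F r) \<inter> C_star F
    \<and> onesided_singular_subdiff (minimal_time \<Omega> F) xbar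
           \<subseteq> normal_cone xbar (enlargement \<Omega> F r) \<inter> F_star_plus F
    \<and> (seq_weak_star_continuous_on
           (uminus ` (normal_cone xbar (enlargement \<Omega> F r) \<inter> C_star F)) (support_fun F)
         \<and> locally_lipschitz_around (minimal_time \<Omega> F) xbar
       \<longrightarrow> onesided_subdiff (minimal_time \<Omega> F) xbar
           = normal_cone xbar (enlargement \<Omega> F r) \<inter> S_star F)
    \<and> (0 \<in> interior F
       \<longrightarrow> normal_cone xbar (enlargement \<Omega> F r)
           = (\<Union>c\<in>{0..}. dilate c (onesided_subdiff (minimal_time \<Omega> F) xbar)))"
proof -
  let ?T = "minimal_time \<Omega> F" and ?N = "normal_cone xbar (enlargement \<Omega> F r)"
  have pos: "0 < ?T xbar" by (rule minimal_time_pos[OF assms(2,5,7)])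
  then have r: "0 \<le> r" using assms(8) by simp
  note sub = onesided_subdiff_subset_normal_cone[OF assms(6,5) r assms(8,9)]
  have sub_C: "onesided_subdiff ?T xbar \<subseteq> ?N \<inter> C_star F"
    using sub(1) onesided_subdiff_subset_C_star[OF assms(6)] by blast
  have S_le_C: "S_star F \<subseteq> C_star F" by (auto simp: S_star_def C_star_def)
  have "onesided_subdiff ?T xbar = ?N \<inter> S_star F"
    if cont: "seq_weak_star_continuous_on (uminus ` (?N \<inter> C_star F)) (support_fun F)"
      and lip: "locally_lipschitz_around ?T xbar"
  proof
    have "seq_weak_star_continuous_on (uminus ` onesided_subdiff ?T xbar) (support_fun F)"
      using cont sub_C unfolding seq_weak_star_continuous_on_def by blast
    then show "onesided_subdiff ?T xbar \<subseteq> ?N \<inter> S_star F"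
      using onesided_subdiff_subset_S_star[OF assms(6,3,5) pos] sub(1) by blast
    have "seq_weak_star_continuous_on (uminus ` (?N \<inter> S_star F)) (support_fun F)"
      using cont S_le_C unfolding seq_weak_star_continuous_on_def by blast
    then show "?N \<inter> S_star F \<subseteq> onesided_subdiff ?T xbar"
      by (rule normal_cone_Int_S_star_subset_onesided_subdiff[OF assms(6,3,5) r assms(8) lip])
  qed
  moreover have "?N = (\<Union>c\<in>{0..}. dilate c (onesided_subdiff ?T xbar))" if int: "0 \<in> interior F"
  proof
    show "?N \<subseteq> (\<Union>c\<in>{0..}. dilate c (onesided_subdiff ?T xbar))"
    proof
      fix xs assume xs: "xs \<in> ?N"
      show "xs \<in> (\<Union>c\<in>{0..}. dilate c (onesided_subdiff ?T xbar))"
      proof (cases "xs = 0")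
        case True
        then have "xs \<in> dilate 0 (onesided_subdiff ?T xbar)" by (auto simp: dilate_def)
        then show ?thesis by force
      next
        case False
        then obtain \<alpha> ys where "0 < \<alpha>" "ys \<in> onesided_subdiff ?T xbar" "xs = \<alpha> *\<^sub>R ys"
          by (rule normal_cone_subset_scaled_onesided_subdiff[OF assms(6,5) r int assms(8) xs])
        then have "0 \<le> \<alpha>" "xs \<in> dilate \<alpha> (onesided_subdiff ?T xbar)" by (auto simp: dilate_def)
        then show ?thesis by blast
      qed
    qed
    have "xbar \<in> enlargement \<Omega> F r" using assms(8) by (simp add: enlargement_def)
    then show "(\<Union>c\<in>{0..}. dilate c (onesided_subdiff ?T xbar)) \<subseteq> ?N"
      using sub(1) by (auto simp: dilate_def zero_in_normal_cone intro: normal_cone_scaleR split: if_splits)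
  qed
  ultimately show ?thesis
    using sub_C sub(2) onesided_singular_subdiff_subset_F_star_plus[OF assms(6)] by blast
qed

end
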